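(* For all integers $r\ge 1$ and $p\ge 5$, the graph $G_{r,p}$ is stiff, has vertex connectivity $1$, and satisfies $\mathrm{Conn}(\mathcal{N}(G_{r,p}))=\min\{2r,p-3\}$.
   Context: Graphs are finite, undirected, without loops or multiple edges. Construction of $G_{r,p}$: put $n=4r+6$ and $S=\{1,3,5,\dots,2r+1\}$. The circulant graph $C_n(S)$ has vertex set $\{1,\dots,n\}$, with $x,y$ adjacent iff $x-y \pmod n\in S\cup -S$, where $-S=\{n-a: a\in S\}$. Let $H_n^p$ be the complete graph on the vertex set $\{n+1,\dots,n+p\}$. Then $G_{r,p}$ is the graph on $\{1,2,\dots,n+p\}$ with edge set $E(C_n(S))\cup E(H_n^p)\cup\{(n+1,1),(n+1,3)\}$. A graph $G$ is stiff if there are no two distinct vertices $u,v$ with $N_G(u)\subseteq N_G(v)$, where $N_G(\cdot)$ is the set of neighbours. The vertex connectivity of a graph is the maximum $k$ such that any two distinct vertices $x,y$ are joined by at least $k$ internally disjoint $xy$-paths. The neighbourhood complex $\mathcal{N}(G)$ is the simplicial complex whose simplices are the subsets $\sigma\subseteq V(G)$ whose elements have a common neighbour in $G$. A nonempty topological space $X$ is $k$-connected if every map from $S^m$ (the $m$-sphere) to $X$ extends to a map from the disk $D^{m+1}$ to $X$, for $m=0,1,\dots,k$; $\mathrm{Conn}(X)$ is the largest integer $k$ such that $X$ is $k$-connected. For a simplicial complex this refers to its geometric realization. *)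

theory Defs
  imports
    "HOL-Analysis.Analysis"
    "Graph_Theory.Pair_Digraph"
    "Graph_Theory.Vertex_Walk"
begin

text \<open>
  Finite simple undirected graphs are the symmetric loop-free finite digraphs
  without parallel arcs of the locale \<^locale>\<open>pair_graph\<close>: an undirected edge
  between x and y is the pair of arcs (x,y), (y,x).
\<close>

definition nbrs :: "'a pair_pre_digraph \<Rightarrow> 'a \<Rightarrow> 'a set" where
  "nbrs G u = {v. (u, v) \<in> parcs G}"

definition stiff :: "'a pair_pre_digraph \<Rightarrow> bool" where
  "stiff G \<longleftrightarrow> \<not> (\<exists>u\<in>pverts G. \<exists>v\<in>pverts G. u \<noteq> v \<and> nbrs G u \<subseteq> nbrs G v)"

text \<open>
  Paths are lists of distinct vertices, so in the set P below the path consisting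
  of a single edge is counted once.
\<close>

definition joined_by_disjoint_paths :: "'a pair_pre_digraph \<Rightarrow> nat \<Rightarrow> 'a \<Rightarrow> 'a \<Rightarrow> bool" where
  "joined_by_disjoint_paths G k x y \<longleftrightarrow>
     (\<exists>P. finite P \<and> k \<le> card P \<and>
          (\<forall>p\<in>P. vpath p (with_proj G) \<and> hd p = x \<and> last p = y) \<and>
          (\<forall>p\<in>P. \<forall>q\<in>P. p \<noteq> q \<longrightarrow> set p \<inter> set q = {x, y}))"

definition all_pairs_joined :: "'a pair_pre_digraph \<Rightarrow> nat \<Rightarrow> bool" where
  "all_pairs_joined G k \<longleftrightarrow>
     (\<forall>x\<in>pverts G. \<forall>y\<in>pverts G. x \<noteq> y \<longrightarrow> joined_by_disjoint_paths G k x y)"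

text \<open>
  Vertex connectivity and Conn are maxima that need not exist (a graph with at most
  one vertex, a contractible or an empty space), so ``the maximum exists and equals k''
  is expressed by a relation.
\<close>

definition has_vertex_connectivity :: "'a pair_pre_digraph \<Rightarrow> nat \<Rightarrow> bool" where
  "has_vertex_connectivity G k \<longleftrightarrow>
     all_pairs_joined G k \<and> (\<forall>j. all_pairs_joined G j \<longrightarrow> j \<le> k)"

definition neighbourhood_complex :: "'a pair_pre_digraph \<Rightarrow> 'a set set" where
  "neighbourhood_complex G =
     {\<sigma>. \<sigma> \<subseteq> pverts G \<and> (\<exists>v\<in>pverts G. \<forall>u\<in>\<sigma>. u \<in> nbrs G v)}"

text \<open>
  Barycentric coordinates with the topology of pointwise convergence. For a complex
  with finitely many vertices this is the usual topology of the geometric realization;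
  for infinite complexes it can be coarser than the weak topology. The empty simplex
  contributes no point, as the coordinates have sum 1.
\<close>

definition geometric_realization :: "'a set set \<Rightarrow> ('a \<Rightarrow> real) topology" where
  "geometric_realization K = subtopology (powertop_real UNIV)
     {t. (\<forall>v. 0 \<le> t v) \<and> {v. t v \<noteq> 0} \<in> K \<and> (\<Sum>v | t v \<noteq> 0. t v) = 1}"

text \<open>The closed unit ball in n-dimensional space; \<^term>\<open>nsphere m\<close> is the boundary
  of \<^term>\<open>ndisk (Suc m)\<close>.\<close>

definition ndisk :: "nat \<Rightarrow> (nat \<Rightarrow> real) topology" where
  "ndisk n = subtopology (Euclidean_space n) {x. (\<Sum>i<n. (x i)\<^sup>2) \<le> 1}"

text \<open>For negative k the condition on spheres is void, and only nonemptiness remains.\<close>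

definition k_connected_space :: "int \<Rightarrow> 'a topology \<Rightarrow> bool" where
  "k_connected_space k X \<longleftrightarrow>
     topspace X \<noteq> {} \<and>
     (\<forall>m::nat. int m \<le> k \<longrightarrow>
        (\<forall>f. continuous_map (nsphere m) X f \<longrightarrow>
           (\<exists>g. continuous_map (ndisk (Suc m)) X g \<and>
                (\<forall>x\<in>topspace (nsphere m). g x = f x))))"

definition has_Conn :: "'a topology \<Rightarrow> int \<Rightarrow> bool" where
  "has_Conn X k \<longleftrightarrow>
     k_connected_space k X \<and> (\<forall>j. k_connected_space j X \<longrightarrow> j \<le> k)"

definition circulant_arcs :: "int \<Rightarrow> int set \<Rightarrow> int rel" where
  "circulant_arcs n S =
     {(x, y). x \<in> {1..n} \<and> y \<in> {1..n} \<and> (x - y) mod n \<in> S \<union> (\<lambda>a. n - a) ` S}"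

definition complete_arcs :: "'a set \<Rightarrow> 'a rel" where
  "complete_arcs V = {(x, y). x \<in> V \<and> y \<in> V \<and> x \<noteq> y}"

definition G_graph :: "int \<Rightarrow> int \<Rightarrow> int pair_pre_digraph" where
  "G_graph r p =
     (let n = 4 * r + 6; S = {s. odd s \<and> 1 \<le> s \<and> s \<le> 2 * r + 1} in
      \<lparr> pverts = {1..n + p},
        parcs = circulant_arcs n S \<union> complete_arcs {n + 1..n + p}
                \<union> {(n + 1, 1), (1, n + 1), (n + 1, 3), (3, n + 1)} \<rparr>)"

lemma circulant_arcs_sym:
  assumes "0 < n" "S \<subseteq> {0<..<n}" "(x, y) \<in> circulant_arcs n S"
  shows "(y, x) \<in> circulant_arcs n S" "x \<noteq> y"
proof -
  let ?d = "(x - y) mod n"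
  have d: "?d \<in> S \<union> (\<lambda>a. n - a) ` S" and xy: "x \<in> {1..n}" "y \<in> {1..n}"
    using assms(3) by (auto simp: circulant_arcs_def)
  then have d0: "?d \<noteq> 0"
    using assms(2) by auto
  then show "x \<noteq> y"
    by auto
  have "(y - x) mod n = n - ?d"
    using zmod_zminus1_eq_if[of "x - y" n] d0 by simp
  then show "(y, x) \<in> circulant_arcs n S"
    using d xy by (auto simp: circulant_arcs_def)
qed

lemma pair_graph_G_graph:
  assumes "1 \<le> r" "1 \<le> p"
  shows "pair_graph (G_graph r p)"
proof -
  let ?n = "4 * r + 6" and ?S = "{s. odd s \<and> 1 \<le> s \<and> s \<le> 2 * r + 1}"
  let ?A = "parcs (G_graph r p)" and ?V = "pverts (G_graph r p)"
  have c: "(y, x) \<in> circulant_arcs ?n ?S" "x \<noteq> y" if "(x, y) \<in> circulant_arcs ?n ?S" for x y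
    using circulant_arcs_sym[of ?n ?S x y] that assms by (auto simp: subset_iff)
  have wf: "?A \<subseteq> ?V \<times> ?V"
    using assms by (auto simp: G_graph_def Let_def circulant_arcs_def complete_arcs_def)
  have fin: "finite ?V"
    by (simp add: G_graph_def Let_def)
  have sym: "sym ?A"
    by (rule symI) (use c in \<open>auto simp: G_graph_def Let_def complete_arcs_def\<close>)
  have irr: "x \<noteq> y" if "(x, y) \<in> ?A" for x y
    using that c(2) assms by (auto simp: G_graph_def Let_def complete_arcs_def)
  show ?thesis
    by unfold_locales
      (use wf fin sym irr finite_subset[OF wf] in \<open>auto simp: symmetric_def\<close>)
qed

end

theory Submission
  imports Defs "HOL-Homology.Brouwer_Degree" "HOL-Real_Asymp.Real_Asymp"
begin

text \<open>
  With m = 2r + 3, the circulant graph is the complete bipartite graph on m + m vertices without a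
  perfect matching, so the facets of the neighbourhood complex are easily listed: the complex
  consists of the boundaries of three simplices (on the odd residues, on the even residues and on
  the clique), joined in a chain by contractible pieces. Up to homotopy it is a wedge of two spheres
  of dimension 2r + 1 and one of dimension p - 2.

  High connectivity follows from the property of extending every map from a closed subset of a
  d-dimensional cube. This property passes from K, L and their intersection to the union of K and L.
  It holds for full simplices by Dugundji's theorem, and for the boundary of a simplex of dimension
  greater than d since a map from a d-cube can be pushed off an interior point: if each coordinate
  function is made locally constant off the walls of its own grid, and these grids are disjoint, then
  at most d coordinates can vary near any point.

  Conversely, the complex retracts simplicially onto each of the three spheres, so that none of them
  can be filled: a filling would give a retraction of the disk onto its boundary.
\<close>

section \<open>Polyhedra\<close>

text \<open>The point set underlying the realization, named so that \<open>closed\<close> and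
  \<open>continuous_on\<close> in the function type can replace abstract topologies.\<close>

definition polyhedron :: "'a set set \<Rightarrow> ('a \<Rightarrow> real) set" where
  "polyhedron K = {t. (\<forall>v. 0 \<le> t v) \<and> {v. t v \<noteq> 0} \<in> K \<and> (\<Sum>v | t v \<noteq> 0. t v) = 1}"

abbreviation boundary :: "'a set \<Rightarrow> 'a set set" where
  "boundary V \<equiv> {\<sigma>. \<sigma> \<subset> V}"

lemma geometric_realization_eq: "geometric_realization K = top_of_set (polyhedron K)"
  by (simp add: geometric_realization_def polyhedron_def euclidean_product_topology)

lemma polyhedron_Un: "polyhedron (K \<union> L) = polyhedron K \<union> polyhedron L"
  by (auto simp: polyhedron_def)

lemma polyhedron_Int: "polyhedron (K \<inter> L) = polyhedron K \<inter> polyhedron L"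
  by (auto simp: polyhedron_def)

lemma sum_support:
  fixes t :: "'a \<Rightarrow> real"
  assumes "finite V" "\<And>v. v \<notin> V \<Longrightarrow> t v = 0"
  shows "(\<Sum>v | t v \<noteq> 0. t v) = sum t V"
  by (rule sum.mono_neutral_left) (use assms in auto)

lemma mem_polyhedron_Pow:
  assumes "finite V"
  shows "t \<in> polyhedron (Pow V) \<longleftrightarrow> (\<forall>v. 0 \<le> t v) \<and> (\<forall>v. v \<notin> V \<longrightarrow> t v = 0) \<and> sum t V = 1"
proof -
  have "{v. t v \<noteq> 0} \<in> Pow V \<longleftrightarrow> (\<forall>v. v \<notin> V \<longrightarrow> t v = 0)"
    by auto
  then show ?thesis
    using sum_support[OF assms, of t] unfolding polyhedron_def mem_Collect_eq by metis
qed

lemma mem_polyhedron_boundary: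
  assumes "finite V"
  shows "t \<in> polyhedron (boundary V) \<longleftrightarrow>
    (\<forall>v. 0 \<le> t v) \<and> (\<forall>v. v \<notin> V \<longrightarrow> t v = 0) \<and> sum t V = 1 \<and> (\<exists>v\<in>V. t v = 0)"
proof -
  have "t \<in> polyhedron (boundary V) \<longleftrightarrow> t \<in> polyhedron (Pow V) \<and> (\<exists>v\<in>V. t v = 0)"
    by (auto simp: polyhedron_def)
  then show ?thesis
    by (simp add: mem_polyhedron_Pow[OF assms] conj_assoc)
qed

lemma continuous_on_coord: "continuous_on S (\<lambda>t::'a \<Rightarrow> real. t v)"
  by (rule continuous_on_product_then_coordinatewise) (rule continuous_on_id)

lemma closed_polyhedron_Pow:
  assumes "finite V"
  shows "closed (polyhedron (Pow V))"
proof -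
  have "polyhedron (Pow V) =
    {t. \<forall>v. 0 \<le> t v} \<inter> {t. \<forall>v. v \<notin> V \<longrightarrow> t v = 0} \<inter> {t. sum t V = 1}"
    by (auto simp: mem_polyhedron_Pow[OF assms])
  then show ?thesis
    by (simp, intro closed_Int closed_Collect_all closed_Collect_imp closed_Collect_le closed_Collect_eq
        continuous_intros) (auto intro: continuous_intros)
qed

lemma closed_polyhedron_boundary:
  assumes "finite V"
  shows "closed (polyhedron (boundary V))"
proof -
  have "boundary V = (\<Union>v\<in>V. Pow (V - {v}))"
    by auto
  then have "polyhedron (boundary V) = (\<Union>v\<in>V. polyhedron (Pow (V - {v})))"
    by (auto simp: polyhedron_def)
  then show ?thesis
    using assms by (auto intro!: closed_UN closed_polyhedron_Pow)
qed

lemma continuous_on_Min_image: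
  fixes f :: "'b \<Rightarrow> 'a::topological_space \<Rightarrow> real"
  assumes "finite V" "V \<noteq> {}" "\<And>v. v \<in> V \<Longrightarrow> continuous_on S (f v)"
  shows "continuous_on S (\<lambda>x. Min ((\<lambda>v. f v x) ` V))"
  using assms
proof (induction V rule: finite_ne_induct)
  case (insert v V)
  then have "(\<lambda>x. Min ((\<lambda>v. f v x) ` insert v V)) = (\<lambda>x. min (f v x) (Min ((\<lambda>v. f v x) ` V)))"
    by simp
  then show ?case
    using insert by (auto intro!: continuous_on_min)
qed simp

section \<open>Projection along the diagonal\<close>

text \<open>Translating along the all-ones vector makes the least coordinate 0, and scaling makes
  the sum 1. This projects the complement of the diagonal onto the boundary of the simplex.\<close>

definition recentre :: "'a set \<Rightarrow> ('a \<Rightarrow> real) \<Rightarrow> 'a \<Rightarrow> real" where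
  "recentre V t = (\<lambda>v. if v \<in> V then (t v - Min (t ` V)) / (\<Sum>w\<in>V. t w - Min (t ` V)) else 0)"

lemma recentre_denominator_pos:
  fixes t :: "'a \<Rightarrow> real"
  assumes "finite V" "\<exists>v\<in>V. \<exists>w\<in>V. t v \<noteq> t w"
  shows "0 < (\<Sum>w\<in>V. t w - Min (t ` V))"
proof -
  have le: "Min (t ` V) \<le> t v" if "v \<in> V" for v
    using assms that by auto
  from assms obtain v w where "v \<in> V" "w \<in> V" "t v < t w"
    by (metis linorder_neqE_linordered_idom)
  then have "w \<in> V" "0 < t w - Min (t ` V)"
    using le[of v] by auto
  then show ?thesis
    using assms(1) le by (intro sum_pos2) auto
qed

lemma recentre_in_boundary:
  assumes "finite V" "\<exists>v\<in>V. \<exists>w\<in>V. t v \<noteq> t w"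
  shows "recentre V t \<in> polyhedron (boundary V)"
proof -
  let ?s = "\<Sum>w\<in>V. t w - Min (t ` V)"
  have s: "0 < ?s"
    by (rule recentre_denominator_pos[OF assms])
  have "Min (t ` V) \<in> t ` V"
    using assms by (intro Min_in) auto
  then obtain u where "u \<in> V" "t u = Min (t ` V)"
    by auto
  then have "\<exists>v\<in>V. recentre V t v = 0"
    by (auto simp: recentre_def)
  moreover have "0 \<le> recentre V t v" for v
    using assms s by (auto simp: recentre_def intro!: divide_nonneg_pos)
  moreover have "sum (recentre V t) V = (\<Sum>v\<in>V. (t v - Min (t ` V)) / ?s)"
    by (intro sum.cong) (auto simp: recentre_def)
  then have "sum (recentre V t) V = 1"
    using s by (simp flip: sum_divide_distrib)
  ultimately show ?thesis
    by (auto simp: mem_polyhedron_boundary[OF assms(1)] recentre_def)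
qed

lemma recentre_boundary:
  assumes "finite V" "t \<in> polyhedron (boundary V)"
  shows "recentre V t = t"
proof -
  have t: "\<And>v. 0 \<le> t v" "\<And>v. v \<notin> V \<Longrightarrow> t v = 0" "sum t V = 1" and "\<exists>v\<in>V. t v = 0"
    using assms by (auto simp: mem_polyhedron_boundary)
  then have "Min (t ` V) = 0"
    using assms(1) by (intro Min_eqI) force+
  then show ?thesis
    using t by (auto simp: recentre_def)
qed

lemma boundary_not_diagonal:
  assumes "finite V" "t \<in> polyhedron (boundary V)"
  shows "\<exists>v\<in>V. \<exists>w\<in>V. t v \<noteq> t w"
proof (rule ccontr)
  assume eq: "\<not> ?thesis"
  have t: "sum t V = 1" and "\<exists>v\<in>V. t v = 0"
    using assms by (auto simp: mem_polyhedron_boundary)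
  then have "\<forall>v\<in>V. t v = 0"
    using eq by metis
  then show False
    using t by simp
qed

lemma continuous_on_recentre:
  assumes V: "finite V" and f: "\<And>v. v \<in> V \<Longrightarrow> continuous_on S (\<lambda>x. f x v)"
    and nd: "\<And>x. x \<in> S \<Longrightarrow> \<exists>v\<in>V. \<exists>w\<in>V. f x v \<noteq> f x w"
  shows "continuous_on S (\<lambda>x. recentre V (f x))"
proof (cases "V = {}")
  case False
  then have M: "continuous_on S (\<lambda>x. Min (f x ` V))"
    by (intro continuous_on_Min_image[OF V, of S "\<lambda>v x. f x v"]) (use f in auto)
  have "continuous_on S (\<lambda>x. recentre V (f x) v)" for v
  proof (cases "v \<in> V")
    case True
    have "(\<Sum>w\<in>V. f x w - Min (f x ` V)) \<noteq> 0" if "x \<in> S" for x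
      using recentre_denominator_pos[OF V nd[OF that]] by simp
    then show ?thesis
      using True f by (auto simp: recentre_def simp del: sum_subtractf intro!: continuous_intros M)
  qed (simp add: recentre_def)
  then show ?thesis
    by (rule continuous_on_coordinatewise_then_product)
qed (simp add: recentre_def)

section \<open>Extension of maps from closed subsets of a cube\<close>

text \<open>Zero padding puts the cubes of all dimensions into one type, the one in which
  \<open>nsphere\<close> and \<open>ndisk\<close> live.\<close>

definition cube :: "nat \<Rightarrow> (nat \<Rightarrow> real) set" where
  "cube d = {x. (\<forall>i<d. \<bar>x i\<bar> \<le> 1) \<and> (\<forall>i\<ge>d. x i = 0)}"

text \<open>The absolute extensor property, restricted to closed subsets of a d-cube. Arbitrary
  closed S make gluing possible; the case \<open>S = {}\<close> forces Y to be nonempty.\<close>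

definition cube_extensor :: "nat \<Rightarrow> ('a \<Rightarrow> real) set \<Rightarrow> bool" where
  "cube_extensor d Y \<longleftrightarrow>
     (\<forall>S f. closed S \<longrightarrow> S \<subseteq> cube d \<longrightarrow> continuous_on S f \<longrightarrow> f ` S \<subseteq> Y \<longrightarrow>
        (\<exists>g. continuous_on (cube d) g \<and> g ` cube d \<subseteq> Y \<and> (\<forall>x\<in>S. g x = f x)))"

lemma cube_extensorE:
  assumes "cube_extensor d Y" "closed S" "S \<subseteq> cube d" "continuous_on S f" "f ` S \<subseteq> Y"
  obtains g where "continuous_on (cube d) g" "g ` cube d \<subseteq> Y" "\<And>x. x \<in> S \<Longrightarrow> g x = f x"
proof -
  have "\<exists>g. continuous_on (cube d) g \<and> g ` cube d \<subseteq> Y \<and> (\<forall>x\<in>S. g x = f x)"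
    by (rule assms(1)[unfolded cube_extensor_def, rule_format, OF assms(2-5)])
  then show ?thesis
    using that by metis
qed

lemma compact_cube: "compact (cube d)"
proof -
  have eq: "cube d = (\<Pi>\<^sub>E i\<in>UNIV. if i < d then {-1..1} else {0::real})"
    by (auto simp: cube_def PiE_iff abs_le_iff split: if_splits)
  have "compactin (powertop_real UNIV) (\<Pi>\<^sub>E i\<in>UNIV. if i < d then {-1..1} else {0::real})"
    by (auto simp: compactin_PiE)
  then show ?thesis
    unfolding eq by (simp add: euclidean_product_topology)
qed

lemma closed_cube: "closed (cube d)"
  by (simp add: compact_cube compact_imp_closed)

lemma cube_extensor_Pow:
  assumes V: "finite V" "V \<noteq> {}"
  shows "cube_extensor d (polyhedron (Pow V))"
  unfolding cube_extensor_def
proof (intro allI impI)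
  fix S and f :: "(nat \<Rightarrow> real) \<Rightarrow> 'a \<Rightarrow> real"
  assume S: "closed S" "S \<subseteq> cube d" and f: "continuous_on S f" "f ` S \<subseteq> polyhedron (Pow V)"
  have "\<exists>h. continuous_on UNIV h \<and> (\<forall>x. 0 \<le> h x) \<and> (\<forall>x\<in>S. h x = f x v)" for v
  proof -
    have c: "continuous_on S (\<lambda>x. f x v)"
      by (rule continuous_on_product_then_coordinatewise[OF f(1)])
    have "(\<lambda>x. f x v) ` S \<subseteq> {0..}"
      using f(2) by (auto simp: mem_polyhedron_Pow[OF V(1)])
    moreover have "closedin (top_of_set UNIV) S"
      using S by simp
    ultimately obtain h where "continuous_on UNIV h" "h ` UNIV \<subseteq> {0..}" "\<And>x. x \<in> S \<Longrightarrow> h x = f x v"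
      using Dugundji[OF convex_real_interval(1)[of 0] _ _ c] by (metis atLeast_iff empty_iff order_refl)
    then show ?thesis
      by (intro exI[of _ h]) auto
  qed
  then obtain h where h: "\<And>v. continuous_on UNIV (h v)" "\<And>v x. 0 \<le> h v x"
      "\<And>v x. x \<in> S \<Longrightarrow> h v x = f x v"
    by metis
  obtain v0 where v0: "v0 \<in> V"
    using V by auto
  define s where "s x = (\<Sum>v\<in>V. h v x)" for x
  \<comment> \<open>A deficit of the sum s below 1 is placed on v0, and an excess is divided out. On
    S the sum is 1, so neither correction changes f there.\<close>
  define g where "g x v = (if v \<in> V then (h v x + (if v = v0 then max 0 (1 - s x) else 0)) / max 1 (s x) else 0)"
    for x v
  have cs: "continuous_on UNIV s"
    unfolding s_def by (intro continuous_intros h)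
  have "continuous_on UNIV (\<lambda>x. g x v)" for v
  proof -
    have "max 1 (s x) \<noteq> 0" for x
      by linarith
    then show ?thesis
      unfolding g_def by (cases "v \<in> V"; cases "v = v0") (auto intro!: continuous_intros cs h)
  qed
  then have "continuous_on UNIV g"
    by (rule continuous_on_coordinatewise_then_product)
  then have "continuous_on (cube d) g"
    by (rule continuous_on_subset) simp
  moreover have "g x \<in> polyhedron (Pow V)" for x
  proof -
    have "sum (g x) V = (\<Sum>v\<in>V. (h v x + (if v = v0 then max 0 (1 - s x) else 0)) / max 1 (s x))"
      by (intro sum.cong) (auto simp: g_def)
    also have "\<dots> = (s x + max 0 (1 - s x)) / max 1 (s x)"
      using V v0 by (simp add: sum.distrib s_def flip: sum_divide_distrib)
    also have "\<dots> = 1"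
      by (auto simp: max_def)
    finally show ?thesis
      using h(2) by (auto simp: mem_polyhedron_Pow[OF V(1)] g_def intro!: divide_nonneg_nonneg add_nonneg_nonneg)
  qed
  moreover have "g x = f x" if "x \<in> S" for x
  proof
    fix v
    have fx: "f x \<in> polyhedron (Pow V)"
      using that f by auto
    then have "s x = 1"
      using h(3)[OF that] by (simp add: s_def mem_polyhedron_Pow[OF V(1)])
    then show "g x v = f x v"
      using h(3)[OF that] fx by (simp add: g_def mem_polyhedron_Pow[OF V(1)])
  qed
  ultimately show "\<exists>g. continuous_on (cube d) g \<and> g ` cube d \<subseteq> polyhedron (Pow V) \<and> (\<forall>x\<in>S. g x = f x)"
    by blast
qed

text \<open>The cube is cut into closed parts P' and Q' that meet S in the preimages P of U and Q of
  W. First f is extended from P \<inter> Q into U \<inter> W, which fixes the values on the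
  interface R = P' \<inter> Q'. Extending these together with f into U over P' and into W over Q'
  gives two maps that agree on R.\<close>

lemma cube_extensor_Un:
  assumes U: "cube_extensor d U" "closed U" and W: "cube_extensor d W" "closed W"
    and UW: "cube_extensor d (U \<inter> W)"
  shows "cube_extensor d (U \<union> W)"
  unfolding cube_extensor_def
proof (intro allI impI)
  fix S and f :: "(nat \<Rightarrow> real) \<Rightarrow> 'a \<Rightarrow> real"
  assume S: "closed S" "S \<subseteq> cube d" and f: "continuous_on S f" "f ` S \<subseteq> U \<union> W"
  define P where "P = S \<inter> f -` U"
  define Q where "Q = S \<inter> f -` W"
  have PQ: "closed P" "closed Q" "P \<union> Q = S"
    using f U W S by (auto simp: P_def Q_def intro: continuous_closed_preimage)
  have fP: "f ` P \<subseteq> U" and fQ: "f ` Q \<subseteq> W"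
    by (auto simp: P_def Q_def)
  have c: "continuous_on P f" "continuous_on Q f"
    using f PQ by (auto intro: continuous_on_subset)
  have "\<exists>g. continuous_on (cube d) g \<and> g ` cube d \<subseteq> U \<union> W \<and> (\<forall>x\<in>S. g x = f x)"
    if "cube_extensor d Y" "f ` S \<subseteq> Y" "Y \<subseteq> U \<union> W" for Y
    using cube_extensorE[OF that(1) S f(1) that(2)] that(3) by (metis subset_trans)
  note single = this
  \<comment> \<open>Empty preimages are treated apart because \<open>infdist x {}\<close> is 0 by
    convention, so comparing distances would tell nothing.\<close>
  consider "P = {}" | "Q = {}" | "P \<noteq> {}" "Q \<noteq> {}"
    by blast
  then show "\<exists>g. continuous_on (cube d) g \<and> g ` cube d \<subseteq> U \<union> W \<and> (\<forall>x\<in>S. g x = f x)"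
  proof cases
    case 1
    then show ?thesis
      using PQ fQ by (intro single[OF W(1)]) auto
  next
    case 2
    then show ?thesis
      using PQ fP by (intro single[OF U(1)]) auto
  next
    case 3
    \<comment> \<open>A closed cover of the cube which traces the cover P, Q on S.\<close>
    define P' where "P' = {x \<in> cube d. infdist x P \<le> infdist x Q}"
    define Q' where "Q' = {x \<in> cube d. infdist x Q \<le> infdist x P}"
    have cl: "closed P'" "closed Q'"
      unfolding P'_def Q'_def Collect_conj_eq
      by (auto intro!: closed_Int closed_cube closed_Collect_le continuous_intros)
    have cov: "P' \<union> Q' = cube d"
      by (auto simp: P'_def Q'_def)
    have mem: "infdist x P = 0 \<longleftrightarrow> x \<in> P" "infdist x Q = 0 \<longleftrightarrow> x \<in> Q" for x
      using 3 PQ by (simp_all add: in_closed_iff_infdist_zero)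
    have sub: "P \<subseteq> P'" "Q \<subseteq> Q'"
      using S PQ mem by (auto simp: P'_def Q'_def infdist_nonneg)
    have tr: "P' \<inter> S \<subseteq> P" "Q' \<inter> S \<subseteq> Q"
    proof -
      have "infdist x P = 0" if "x \<in> S" "infdist x P \<le> infdist x Q" for x
        using that PQ(3) mem[of x] infdist_nonneg[of x P] by (cases "x \<in> P") auto
      then show "P' \<inter> S \<subseteq> P"
        unfolding P'_def using mem(1) by blast
      have "infdist x Q = 0" if "x \<in> S" "infdist x Q \<le> infdist x P" for x
        using that PQ(3) mem[of x] infdist_nonneg[of x Q] by (cases "x \<in> Q") auto
      then show "Q' \<inter> S \<subseteq> Q"
        unfolding Q'_def using mem(2) by blast
    qed
    have fPQ: "f ` (P \<inter> Q) \<subseteq> U \<inter> W"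
      using fP fQ by auto
    have "closed (P \<inter> Q)" "P \<inter> Q \<subseteq> cube d"
      using PQ S by auto
    then obtain h where h: "continuous_on (cube d) h" "h ` cube d \<subseteq> U \<inter> W"
        "\<And>x. x \<in> P \<inter> Q \<Longrightarrow> h x = f x"
      using cube_extensorE[OF UW _ _ _ fPQ] continuous_on_subset[OF c(1), of "P \<inter> Q"] by blast
    define R where "R = P' \<inter> Q'"
    have R: "closed R" "R \<subseteq> cube d"
      using cl cov by (auto simp: R_def)
    have hR: "continuous_on R h" "h ` R \<subseteq> U" "h ` R \<subseteq> W"
      using continuous_on_subset[OF h(1) R(2)] h(2) image_mono[OF R(2), of h] by blast+
    have RS: "R \<inter> S \<subseteq> P \<inter> Q"
      using tr by (auto simp: R_def)
    have ext: "\<exists>g. continuous_on (cube d) g \<and> g ` cube d \<subseteq> Y \<and> (\<forall>x\<in>R. g x = h x) \<and> (\<forall>x\<in>A. g x = f x)"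
      if Y: "cube_extensor d Y" and A: "closed A" "A \<subseteq> S" "continuous_on A f" "f ` A \<subseteq> Y" and "h ` R \<subseteq> Y"
      for A Y
    proof -
      have agree: "h x = f x" if "x \<in> R" "x \<in> A" for x
        using that RS A h(3) by blast
      define k where "k x = (if x \<in> R then h x else f x)" for x
      have "continuous_on (R \<union> A) k"
        unfolding k_def
        by (rule continuous_on_If[OF _ _ hR(1) A(3)])
           (use R(1) A(1) agree in \<open>auto simp: closed_subset\<close>)
      moreover have "k ` (R \<union> A) \<subseteq> Y"
        using A \<open>h ` R \<subseteq> Y\<close> by (auto simp: k_def)
      moreover have "closed (R \<union> A)" "R \<union> A \<subseteq> cube d"
        using R A S by auto
      ultimately obtain g where "continuous_on (cube d) g" "g ` cube d \<subseteq> Y"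
          "\<And>x. x \<in> R \<union> A \<Longrightarrow> g x = k x"
        using cube_extensorE[OF Y, of "R \<union> A" k] by blast
      then show ?thesis
        using agree by (intro exI[of _ g]) (auto simp: k_def)
    qed
    have "P \<subseteq> S" "Q \<subseteq> S"
      using PQ by auto
    obtain g where g: "continuous_on (cube d) g" "g ` cube d \<subseteq> U" "\<And>x. x \<in> R \<Longrightarrow> g x = h x" "\<And>x. x \<in> P \<Longrightarrow> g x = f x"
      using ext[OF U(1) PQ(1) \<open>P \<subseteq> S\<close> c(1) fP hR(2)] by blast
    obtain g' where g': "continuous_on (cube d) g'" "g' ` cube d \<subseteq> W" "\<And>x. x \<in> R \<Longrightarrow> g' x = h x" "\<And>x. x \<in> Q \<Longrightarrow> g' x = f x"
      using ext[OF W(1) PQ(2) \<open>Q \<subseteq> S\<close> c(2) fQ hR(3)] by blast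
    define k where "k x = (if x \<in> P' then g x else g' x)" for x
    have "P' \<subseteq> cube d" "Q' \<subseteq> cube d"
      using cov by auto
    note cgg = continuous_on_subset[OF g(1) this(1)] continuous_on_subset[OF g'(1) this(2)]
    have "continuous_on (P' \<union> Q') k"
      unfolding k_def
      by (rule continuous_on_If[OF _ _ cgg]) (use cl g(3) g'(3) in \<open>auto simp: R_def closed_subset\<close>)
    moreover have "k ` cube d \<subseteq> U \<union> W"
      using g(2) g'(2) unfolding k_def image_subset_iff by simp
    moreover have "k x = f x" if "x \<in> S" for x
    proof (cases "x \<in> P'")
      case True
      then show ?thesis
        using that tr(1) g(4) by (auto simp: k_def)
    next
      case False
      then have "x \<in> Q"
        using that sub(1) PQ(3) by auto
      then show ?thesis
        using False g'(4) by (simp add: k_def)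
    qed
    ultimately show ?thesis
      unfolding cov by blast
  qed
qed

section \<open>Staircase perturbations\<close>

definition unit_clamp :: "real \<Rightarrow> real" where
  "unit_clamp z = max 0 (min 1 z)"

text \<open>
  For \<^term>\<open>i < m\<close> this function of y stays within distance 1 of y on [0,K] and increases only on the
  intervals ]k + i/m, k + (i+1)/m[; these are disjoint for different i.
\<close>

definition staircase :: "nat \<Rightarrow> nat \<Rightarrow> nat \<Rightarrow> real \<Rightarrow> real" where
  "staircase m i K y = (\<Sum>k<K. unit_clamp (real m * (y - real k) - real i))"

lemma continuous_on_unit_clamp [continuous_intros]:
  "continuous_on S f \<Longrightarrow> continuous_on S (\<lambda>x. unit_clamp (f x))"
  unfolding unit_clamp_def by (intro continuous_intros)

text \<open>For \<open>0 \<le> z\<close> the k-th term is the length of the part of [0,z] inside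
  [k,k+1]. These sums of ramps of slope 1 are the comparison functions for staircases.\<close>

lemma sum_unit_clamp: "(\<Sum>k<K. unit_clamp (z - real k)) = max 0 (min z (real K))"
  by (induction K) (auto simp: unit_clamp_def max_def min_def)

text \<open>The steep ramp over [k + i/m, k + (i+1)/m] lies between the ramps of slope 1 over
  [k+1, k+2] and [k-1, k]. Summing over k bounds the staircase by the clamped y - 1 and y +
  1.\<close>

lemma staircase_bounds:
  assumes "i < m" "0 \<le> y" "y \<le> real K"
  shows "\<bar>staircase m i K y - y\<bar> \<le> 1" "0 \<le> staircase m i K y" "staircase m i K y \<le> real K"
proof -
  have m: "real i + 1 \<le> real m"
    using assms by linarith
  have lo: "unit_clamp (y - 1 - real k) \<le> unit_clamp (real m * (y - real k) - real i)" for k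
  proof (cases "y - real k \<le> 1")
    case False
    then have "real m * 1 \<le> real m * (y - real k)"
      by (intro mult_left_mono) auto
    then have "1 \<le> real m * (y - real k) - real i"
      using m by linarith
    then show ?thesis
      by (simp add: unit_clamp_def)
  qed (simp add: unit_clamp_def)
  have hi: "unit_clamp (real m * (y - real k) - real i) \<le> unit_clamp (y + 1 - real k)" for k
  proof (cases "y - real k \<le> 0")
    case True
    then have "real m * (y - real k) \<le> 0"
      by (simp add: mult_nonneg_nonpos)
    then show ?thesis
      by (simp add: unit_clamp_def)
  qed (simp add: unit_clamp_def)
  have "max 0 (min (y - 1) (real K)) \<le> staircase m i K y"
    unfolding staircase_def sum_unit_clamp[symmetric] by (intro sum_mono lo)
  moreover have "staircase m i K y \<le> max 0 (min (y + 1) (real K))"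
    unfolding staircase_def sum_unit_clamp[symmetric] by (intro sum_mono hi)
  ultimately show "\<bar>staircase m i K y - y\<bar> \<le> 1" "0 \<le> staircase m i K y" "staircase m i K y \<le> real K"
    using assms by (auto simp: max_def min_def split: if_splits)
qed

text \<open>At y only the staircase whose index is the residue of
  \<open>\<lfloor>real m * y\<rfloor>\<close> can be rising; every other one has all its clamps at 0
  or 1. The perturbation argument relies on the finiteness of the resulting set of values.\<close>

lemma staircase_locally_constant:
  assumes "i < m" "\<lfloor>real m * y\<rfloor> mod int m \<noteq> int i"
  shows "staircase m i K y \<in> real ` {..K}"
proof -
  have clamp: "unit_clamp (real m * (y - real k) - real i) \<in> real ` {..1}" for k
  proof (rule ccontr)
    let ?z = "real m * (y - real k) - real i"
    assume not01: "\<not> ?thesis"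
    have "unit_clamp ?z = real 0" if "?z \<le> 0"
      using that by (simp add: unit_clamp_def)
    moreover have "unit_clamp ?z = real 1" if "1 \<le> ?z"
      using that by (simp add: unit_clamp_def)
    ultimately have "0 < ?z" "?z < 1"
      using not01 by (metis atMost_iff imageI le_numeral_extra(4) not_le zero_le)+
    then have "\<lfloor>real m * y\<rfloor> = int m * int k + int i"
      by (intro floor_unique) (auto simp: algebra_simps)
    then show False
      using assms by simp
  qed
  have "(\<Sum>k<L. unit_clamp (real m * (y - real k) - real i)) \<in> real ` {..L}" for L
  proof (induction L)
    case (Suc L)
    then obtain a where a: "a \<le> L" "(\<Sum>k<L. unit_clamp (real m * (y - real k) - real i)) = real a"
      by auto
    obtain b where b: "b \<le> 1" "unit_clamp (real m * (y - real L) - real i) = real b"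
      using clamp[of L] by auto
    have "(\<Sum>k<Suc L. unit_clamp (real m * (y - real k) - real i)) = real (a + b)"
      using a b by simp
    moreover have "a + b \<in> {..Suc L}"
      using a b by simp
    ultimately show ?case
      by (metis imageI)
  qed simp
  then show ?thesis
    by (simp add: staircase_def)
qed

text \<open>Each coordinate is rescaled from [-1,1] to [0,2N], moved by the staircase and rescaled
  back, so it moves by at most 1/N. All d coordinates share the index i; different indices will
  belong to different vertices of the simplex.\<close>

definition cube_staircase :: "nat \<Rightarrow> nat \<Rightarrow> nat \<Rightarrow> nat \<Rightarrow> (nat \<Rightarrow> real) \<Rightarrow> nat \<Rightarrow> real" where
  "cube_staircase d m i N x =
     (\<lambda>j. if j < d then staircase m i (2 * N) (real N * (x j + 1)) / real N - 1 else 0)"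

lemma cube_staircase_bounds:
  assumes "i < m" "0 < N" "x \<in> cube d"
  shows "cube_staircase d m i N x \<in> cube d" "\<bar>cube_staircase d m i N x j - x j\<bar> \<le> 1 / real N"
proof -
  have xj: "\<bar>x j\<bar> \<le> 1" if "j < d" for j
    using assms that by (auto simp: cube_def)
  have arg: "0 \<le> real N * (x j + 1)" "real N * (x j + 1) \<le> real (2 * N)" if "j < d" for j
  proof -
    have "real N * (x j + 1) \<le> real N * 2"
      by (rule mult_left_mono) (use xj[OF that] in auto)
    then show "real N * (x j + 1) \<le> real (2 * N)"
      by simp
    show "0 \<le> real N * (x j + 1)"
      by (rule mult_nonneg_nonneg) (use xj[OF that] in auto)
  qed
  note b = staircase_bounds[OF assms(1) arg]
  show "cube_staircase d m i N x \<in> cube d"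
    using b(2,3) assms(2) by (force simp: cube_def cube_staircase_def abs_le_iff field_simps)
  show "\<bar>cube_staircase d m i N x j - x j\<bar> \<le> 1 / real N"
  proof (cases "j < d")
    case True
    have "cube_staircase d m i N x j - x j =
        (staircase m i (2 * N) (real N * (x j + 1)) - real N * (x j + 1)) / real N"
      using True assms(2) by (simp add: cube_staircase_def field_simps)
    also have "\<bar>\<dots>\<bar> \<le> 1 / real N"
      using b(1)[OF True True] assms(2) by (simp add: divide_right_mono)
    finally show ?thesis .
  next
    case False
    then show ?thesis
      using assms(3) by (auto simp: cube_def cube_staircase_def)
  qed
qed

lemma continuous_on_cube_staircase: "continuous_on S (cube_staircase d m i N)"
proof (rule continuous_on_coordinatewise_then_product)
  fix j
  show "continuous_on S (\<lambda>x. cube_staircase d m i N x j)"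
    by (cases "j < d")
       (auto simp: cube_staircase_def staircase_def divide_inverse intro!: continuous_intros continuous_on_coord)
qed

text \<open>The distance on the function type is a sum with weights \<open>(1/2)^n\<close>, whose
  total is the factor 2.\<close>

lemma dist_fun_le:
  fixes x y :: "nat \<Rightarrow> real"
  assumes "\<And>j. \<bar>x j - y j\<bar> \<le> e"
  shows "dist x y \<le> 2 * e"
proof -
  have s: "summable (\<lambda>n. (1/2)^n :: real)"
    by (simp add: summable_geometric_iff)
  have "dist x y = suminf (\<lambda>n. (1/2)^n * min (dist (x (from_nat n)) (y (from_nat n))) 1)"
    by (simp add: dist_fun_def)
  also have "\<dots> \<le> suminf (\<lambda>n. (1/2)^n * e)"
  proof (rule suminf_le)
    show "(1/2)^n * min (dist (x (from_nat n)) (y (from_nat n))) 1 \<le> (1/2)^n * e" for n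
      using assms[of "from_nat n"] by (intro mult_left_mono) (auto simp: dist_real_def)
    show "summable (\<lambda>n. (1/2)^n * min (dist (x (from_nat n)) (y (from_nat n))) 1)"
      by (rule summable_comparison_test'[OF s]) auto
    show "summable (\<lambda>n. (1/2)^n * e)"
      using s by (rule summable_mult2)
  qed
  also have "\<dots> = 2 * e"
    using suminf_mult2[OF s, of e] suminf_geometric[of "1/2::real"] by simp
  finally show ?thesis .
qed

lemma staircase_approximation:
  fixes F :: "(nat \<Rightarrow> real) \<Rightarrow> real"
  assumes F: "continuous_on (cube d) F" and "i < m" "0 < \<delta>"
  shows "eventually (\<lambda>N. \<forall>x\<in>cube d. \<bar>F (cube_staircase d m i N x) - F x\<bar> < \<delta>) sequentially"
proof -
  have "uniformly_continuous_on (cube d) F"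
    by (rule compact_uniformly_continuous[OF F compact_cube])
  then obtain e where e: "0 < e" "\<And>x y. x \<in> cube d \<Longrightarrow> y \<in> cube d \<Longrightarrow> dist y x < e \<Longrightarrow> dist (F y) (F x) < \<delta>"
    using \<open>0 < \<delta>\<close> unfolding uniformly_continuous_on_def by metis
  have "eventually (\<lambda>N. 2 * (1 / real N) < e) sequentially"
    using e(1) by real_asymp
  then show ?thesis
    using eventually_gt_at_top[of 0]
  proof eventually_elim
    case (elim N)
    show ?case
    proof
      fix x assume x: "x \<in> cube d"
      note b = cube_staircase_bounds[OF \<open>i < m\<close> elim(2) x]
      have "dist (cube_staircase d m i N x) x < e"
        using dist_fun_le[OF b(2)] elim(1) by (rule le_less_trans)
      then show "\<bar>F (cube_staircase d m i N x) - F x\<bar> < \<delta>"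
        using e(2)[OF x b(1)] by (simp add: dist_real_def)
    qed
  qed
qed

text \<open>Each F v is precomposed with the staircase of its own index. At a given x every one of
  the d coordinates lets at most one index rise, so for at least two vertices x is moved to a point
  of a finite grid. Between these only finitely many coincidences of values are possible, and a
  generic small tilt \<open>\<eta> * real (idx v)\<close> avoids them all.\<close>

lemma perturb_off_diagonal:
  fixes F :: "'a \<Rightarrow> (nat \<Rightarrow> real) \<Rightarrow> real"
  assumes V: "finite V" "d + 2 \<le> card V" and F: "\<And>v. v \<in> V \<Longrightarrow> continuous_on (cube d) (F v)"
    and "0 < \<delta>"
  shows "\<exists>G. (\<forall>v\<in>V. continuous_on (cube d) (G v) \<and> (\<forall>x\<in>cube d. \<bar>G v x - F v x\<bar> < \<delta>))
    \<and> (\<forall>x\<in>cube d. \<exists>v\<in>V. \<exists>w\<in>V. G v x \<noteq> G w x)"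
proof -
  define m where "m = card V"
  obtain idx where idx: "bij_betw idx V {0..<m}"
    using ex_bij_betw_finite_nat[OF V(1)] by (auto simp: m_def)
  have idx_less: "idx v < m" if "v \<in> V" for v
    using idx that by (auto simp: bij_betw_def)
  have inj: "inj_on idx V"
    using idx by (simp add: bij_betw_def)
  have "eventually (\<lambda>N. \<forall>v\<in>V. \<forall>x\<in>cube d. \<bar>F v (cube_staircase d m (idx v) N x) - F v x\<bar> < \<delta> / 2) sequentially"
    using V(1) staircase_approximation[OF F idx_less, of _ _ "\<delta> / 2"] \<open>0 < \<delta>\<close>
    by (intro eventually_ball_finite) auto
  then have "eventually (\<lambda>N. 0 < N \<and> (\<forall>v\<in>V. \<forall>x\<in>cube d. \<bar>F v (cube_staircase d m (idx v) N x) - F v x\<bar> < \<delta> / 2)) sequentially"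
    using eventually_gt_at_top[of 0] by eventually_elim blast
  then obtain N where N: "0 < N"
      "\<And>v x. v \<in> V \<Longrightarrow> x \<in> cube d \<Longrightarrow> \<bar>F v (cube_staircase d m (idx v) N x) - F v x\<bar> < \<delta> / 2"
    by (auto simp: eventually_at_top_linorder)
  define Q where "Q v = cube_staircase d m (idx v) N" for v
  define grid where "grid = {y. \<forall>j. (j \<in> {..<d} \<longrightarrow> y j \<in> (\<lambda>k. real k / real N - 1) ` {..2 * N}) \<and> (j \<notin> {..<d} \<longrightarrow> y j = 0)}"
  have "finite grid"
    unfolding grid_def by (rule finite_set_of_finite_funs) auto
  \<comment> \<open>The vertices whose staircase may be rising in some coordinate of x. A coordinate
    determines one residue modulo m, hence at most one such vertex.\<close>
  define bad where "bad x = {v \<in> V. \<exists>j<d. \<lfloor>real m * (real N * (x j + 1))\<rfloor> mod int m = int (idx v)}" for x :: "nat \<Rightarrow> real"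
  have card_bad: "card (bad x) \<le> d" for x
  proof -
    have "(\<lambda>v. int (idx v)) ` bad x \<subseteq> (\<lambda>j. \<lfloor>real m * (real N * (x j + 1))\<rfloor> mod int m) ` {..<d}"
    proof (rule image_subsetI)
      fix v assume "v \<in> bad x"
      then obtain j where "j < d" "\<lfloor>real m * (real N * (x j + 1))\<rfloor> mod int m = int (idx v)"
        unfolding bad_def by blast
      then show "int (idx v) \<in> (\<lambda>j. \<lfloor>real m * (real N * (x j + 1))\<rfloor> mod int m) ` {..<d}"
        by (intro image_eqI[where x = j]) auto
    qed
    then have "card ((\<lambda>v. int (idx v)) ` bad x) \<le> card {..<d}"
      by (meson card_image_le card_mono finite_imageI finite_lessThan le_trans)
    moreover have "inj_on (\<lambda>v. int (idx v)) (bad x)"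
      using inj by (auto simp: bad_def inj_on_def)
    ultimately show ?thesis
      by (simp add: card_image)
  qed
  have Q_grid: "Q v x \<in> grid" if "v \<in> V" "v \<notin> bad x" for v x
  proof -
    have "staircase m (idx v) (2 * N) (real N * (x j + 1)) \<in> real ` {..2 * N}" if "j < d" for j
      by (rule staircase_locally_constant) (use idx_less \<open>v \<in> V\<close> \<open>v \<notin> bad x\<close> that in \<open>auto simp: bad_def\<close>)
    then show ?thesis
      by (fastforce simp: grid_def Q_def cube_staircase_def)
  qed
  \<comment> \<open>The slopes \<eta> at which two tilted grid values could coincide. For
    \<open>v = w\<close> division by 0 gives 0, and \<eta> is positive in any case.\<close>
  define forbidden where
    "forbidden = (\<Union>v\<in>V. \<Union>w\<in>V. \<Union>y\<in>grid. \<Union>z\<in>grid. {(F v y - F w z) / (real (idx w) - real (idx v))})"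
  have "finite forbidden"
    using V(1) \<open>finite grid\<close> by (simp add: forbidden_def)
  \<comment> \<open>As \<open>idx v < m\<close>, a slope below e changes values by at most \<delta>
    / 2; the staircases use up the other half.\<close>
  define e where "e = \<delta> / (2 * (real m + 1))"
  have "0 < e"
    using \<open>0 < \<delta>\<close> by (simp add: e_def)
  then have "infinite {0<..<e}"
    by simp
  then have "\<not> {0<..<e} \<subseteq> forbidden"
    using \<open>finite forbidden\<close> finite_subset by blast
  then obtain \<eta> where \<eta>: "0 < \<eta>" "\<eta> < e" "\<eta> \<notin> forbidden"
    unfolding subset_iff by (metis greaterThanLessThan_iff)
  define G where "G v x = F v (Q v x) + \<eta> * real (idx v)" for v x
  show ?thesis
  proof (intro exI[of _ G] conjI ballI)
    fix v assume v: "v \<in> V"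
    have "continuous_on (cube d) (\<lambda>x. F v (Q v x))"
    proof (rule continuous_on_compose2[OF F[OF v]])
      show "Q v ` cube d \<subseteq> cube d"
        using cube_staircase_bounds(1)[OF idx_less[OF v] N(1)] by (auto simp: Q_def)
    qed (simp add: Q_def continuous_on_cube_staircase)
    then show "continuous_on (cube d) (G v)"
      unfolding G_def by (intro continuous_intros)
    fix x assume x: "x \<in> cube d"
    have "\<eta> * real (idx v) \<le> e * (real m + 1)"
      by (rule mult_mono) (use \<eta> idx_less[OF v] in auto)
    also have "\<dots> = \<delta> / 2"
      by (simp add: e_def field_simps)
    finally have "\<eta> * real (idx v) \<le> \<delta> / 2" .
    moreover have "0 \<le> \<eta> * real (idx v)"
      using \<eta> by simp
    ultimately show "\<bar>G v x - F v x\<bar> < \<delta>"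
      using N(2)[OF v x] unfolding G_def Q_def by linarith
  next
    fix x assume x: "x \<in> cube d"
    have "bad x \<subseteq> V"
      by (auto simp: bad_def)
    then have "card (V - bad x) = card V - card (bad x)"
      using V(1) by (simp add: card_Diff_subset finite_subset)
    then have "2 \<le> card (V - bad x)"
      using V(2) card_bad[of x] by linarith
    then obtain v w where vw: "v \<in> V - bad x" "w \<in> V - bad x" "v \<noteq> w"
      by (metis card_2_iff obtain_subset_with_card_n insert_subset)
    then have ne: "real (idx w) - real (idx v) \<noteq> 0"
      using inj by (auto simp: inj_on_def)
    have "G v x \<noteq> G w x"
    proof
      assume "G v x = G w x"
      then have "\<eta> = (F v (Q v x) - F w (Q w x)) / (real (idx w) - real (idx v))"
        using ne by (simp add: G_def field_simps)
      moreover have "(F v (Q v x) - F w (Q w x)) / (real (idx w) - real (idx v)) \<in> forbidden"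
        unfolding forbidden_def using vw Q_grid[of v x] Q_grid[of w x] by blast
      ultimately show False
        using \<eta> by simp
    qed
    then show "\<exists>v\<in>V. \<exists>w\<in>V. G v x \<noteq> G w x"
      using vw by auto
  qed
qed

text \<open>Tietze's theorem extends the coordinates of f, but the extension may hit the diagonal.
  Blending in a perturbation off the diagonal where the spread is small avoids this and leaves f
  alone on S; \<open>recentre\<close> then projects to the boundary.\<close>

lemma cube_extensor_boundary:
  assumes V: "finite V" "d + 2 \<le> card V"
  shows "cube_extensor d (polyhedron (boundary V))"
  unfolding cube_extensor_def
proof (intro allI impI)
  fix S and f :: "(nat \<Rightarrow> real) \<Rightarrow> 'a \<Rightarrow> real"
  assume S: "closed S" "S \<subseteq> cube d" and f: "continuous_on S f" "f ` S \<subseteq> polyhedron (boundary V)"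
  have "\<exists>h. continuous_on UNIV h \<and> (\<forall>x\<in>S. h x = f x v)" for v
  proof -
    have c: "continuous_on S (\<lambda>x. f x v)"
      by (rule continuous_on_product_then_coordinatewise[OF f(1)])
    show ?thesis
      using Tietze_unbounded[OF c, of UNIV] S(1) by (metis closed_closedin subtopology_UNIV)
  qed
  then obtain F where F: "\<And>v. continuous_on UNIV (F v)" "\<And>v x. x \<in> S \<Longrightarrow> F v x = f x v"
    by metis
  have Fc: "continuous_on (cube d) (F v)" for v
    by (rule continuous_on_subset[OF F(1)]) simp
  define m where "m = real (card V)"
  have m: "2 \<le> m"
    using V(2) by (simp add: m_def)
  \<comment> \<open>The spread below has m^2 terms. If H is diagonal at x and within \<delta> of F,
    each term is at most 2 \<delta> and the spread of F is at most 1/2, where \<phi> is already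
    1.\<close>
  define \<delta> where "\<delta> = 1 / (4 * m\<^sup>2)"
  have "0 < \<delta>"
    using m by (simp add: \<delta>_def)
  obtain G where G: "\<And>v. v \<in> V \<Longrightarrow> continuous_on (cube d) (G v)"
    "\<And>v x. v \<in> V \<Longrightarrow> x \<in> cube d \<Longrightarrow> \<bar>G v x - F v x\<bar> < \<delta>"
    "\<And>x. x \<in> cube d \<Longrightarrow> \<exists>v\<in>V. \<exists>w\<in>V. G v x \<noteq> G w x"
    using perturb_off_diagonal[of V d F \<delta>, OF V Fc \<open>0 < \<delta>\<close>] by metis
  \<comment> \<open>The spread of a vector vanishes exactly on the diagonal, and is at least 1 on the boundary of
    the simplex. The perturbation is switched on where the spread of F is small.\<close>
  define spread where "spread t = (\<Sum>v\<in>V. \<Sum>w\<in>V. \<bar>t v - t w\<bar>)" for t :: "'a \<Rightarrow> real"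
  define \<phi> where "\<phi> x = unit_clamp (2 - 2 * spread (\<lambda>v. F v x))" for x
  define H where "H x v = F v x + \<phi> x * (G v x - F v x)" for x v
  have \<phi>: "0 \<le> \<phi> x" "\<phi> x \<le> 1" for x
    by (auto simp: \<phi>_def unit_clamp_def)
  have "continuous_on (cube d) \<phi>"
    unfolding \<phi>_def spread_def by (intro continuous_intros Fc)
  then have Hc: "continuous_on (cube d) (\<lambda>x. H x v)" if "v \<in> V" for v
    unfolding H_def by (intro continuous_intros Fc G that)
  have nd: "\<exists>v\<in>V. \<exists>w\<in>V. H x v \<noteq> H x w" if x: "x \<in> cube d" for x
  proof (cases "\<phi> x = 1")
    case True
    then show ?thesis
      using G(3)[OF x] by (simp add: H_def)
  next
    case False
    then have s: "1 / 2 < spread (\<lambda>v. F v x)"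
      by (auto simp: \<phi>_def unit_clamp_def max_def min_def split: if_splits)
    show ?thesis
    proof (rule ccontr)
      assume "\<not> ?thesis"
      then have eq: "H x v = H x w" if "v \<in> V" "w \<in> V" for v w
        using that by blast
      have HF: "\<bar>H x v - F v x\<bar> \<le> \<delta>" if "v \<in> V" for v
      proof -
        have "\<bar>H x v - F v x\<bar> = \<phi> x * \<bar>G v x - F v x\<bar>"
          using \<phi> by (simp add: H_def abs_mult)
        also have "\<dots> \<le> 1 * \<delta>"
          by (rule mult_mono) (use \<phi> G(2)[OF that x] in auto)
        finally show ?thesis
          by simp
      qed
      have "\<bar>F v x - F w x\<bar> \<le> 2 * \<delta>" if "v \<in> V" "w \<in> V" for v w
        using HF[OF that(1)] HF[OF that(2)] eq[OF that] by linarith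
      then have "spread (\<lambda>v. F v x) \<le> (\<Sum>v\<in>V. \<Sum>w\<in>V. 2 * \<delta>)"
        unfolding spread_def by (intro sum_mono)
      also have "\<dots> = 1 / 2"
        using m by (simp add: \<delta>_def m_def[symmetric] power2_eq_square)
      finally show False
        using s by simp
    qed
  qed
  have "recentre V (H x) = f x" if x: "x \<in> S" for x
  proof -
    have fx: "f x \<in> polyhedron (boundary V)"
      using f(2) x by auto
    then obtain u where u: "u \<in> V" "f x u = 0" and t: "\<And>v. 0 \<le> f x v" "sum (f x) V = 1"
      by (auto simp: mem_polyhedron_boundary[OF V(1)])
    \<comment> \<open>The terms with \<open>w = u\<close> alone add up to the coordinate sum, so the
      spread is at least 1 on S and \<phi> vanishes there.\<close>
    have "1 = (\<Sum>v\<in>V. \<bar>f x v - f x u\<bar>)"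
      using u t by simp
    also have "\<dots> \<le> (\<Sum>v\<in>V. \<Sum>w\<in>V. \<bar>f x v - f x w\<bar>)"
      by (intro sum_mono member_le_sum) (use u V in auto)
    also have "\<dots> = spread (\<lambda>v. F v x)"
      using F(2)[OF x] by (simp add: spread_def)
    finally have "\<phi> x = 0"
      by (simp add: \<phi>_def unit_clamp_def)
    then have "H x = f x"
      using F(2)[OF x] by (auto simp: H_def)
    then show ?thesis
      using recentre_boundary[OF V(1) fx] by simp
  qed
  moreover have "continuous_on (cube d) (\<lambda>x. recentre V (H x))"
    by (rule continuous_on_recentre[OF V(1) Hc nd])
  moreover have "(\<lambda>x. recentre V (H x)) ` cube d \<subseteq> polyhedron (boundary V)"
    using recentre_in_boundary[OF V(1) nd] by auto
  ultimately show "\<exists>g. continuous_on (cube d) g \<and> g ` cube d \<subseteq> polyhedron (boundary V) \<and> (\<forall>x\<in>S. g x = f x)"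
    by blast
qed

section \<open>Spheres and connectivity\<close>

definition sphere_set :: "nat \<Rightarrow> (nat \<Rightarrow> real) set" where
  "sphere_set m = {x. (\<forall>i\<ge>Suc m. x i = 0) \<and> (\<Sum>i\<le>m. (x i)\<^sup>2) = 1}"

definition disk_set :: "nat \<Rightarrow> (nat \<Rightarrow> real) set" where
  "disk_set n = {x. (\<forall>i\<ge>n. x i = 0) \<and> (\<Sum>i<n. (x i)\<^sup>2) \<le> 1}"

lemma nsphere_eq: "nsphere m = top_of_set (sphere_set m)"
  by (simp add: nsphere_def Euclidean_space_def euclidean_product_topology subtopology_subtopology
      sphere_set_def Collect_conj_eq)

lemma ndisk_eq: "ndisk n = top_of_set (disk_set n)"
  by (simp add: ndisk_def Euclidean_space_def euclidean_product_topology subtopology_subtopology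
      disk_set_def Collect_conj_eq)

lemma sphere_subset_disk: "sphere_set m \<subseteq> disk_set (Suc m)"
  by (auto simp: sphere_set_def disk_set_def lessThan_Suc_atMost)

lemma disk_subset_cube: "disk_set n \<subseteq> cube n"
proof
  fix x assume x: "x \<in> disk_set n"
  have "\<bar>x i\<bar> \<le> 1" if "i < n" for i
  proof -
    have "(x i)\<^sup>2 \<le> (\<Sum>i<n. (x i)\<^sup>2)"
      by (rule member_le_sum) (use that in auto)
    also have "\<dots> \<le> 1"
      using x by (simp add: disk_set_def)
    finally show ?thesis
      by (simp add: abs_square_le_1)
  qed
  then show "x \<in> cube n"
    using x by (simp add: disk_set_def cube_def)
qed

lemma closed_sphere_set: "closed (sphere_set m)"
  unfolding sphere_set_def Collect_conj_eq
  by (intro closed_Int closed_Collect_all closed_Collect_imp closed_Collect_eq continuous_intros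
      continuous_on_coord) auto

lemma k_connected_space_polyhedron_iff:
  "k_connected_space k (geometric_realization K) \<longleftrightarrow> polyhedron K \<noteq> {} \<and>
     (\<forall>m f. int m \<le> k \<and> continuous_on (sphere_set m) f \<and> f ` sphere_set m \<subseteq> polyhedron K \<longrightarrow>
        (\<exists>g. continuous_on (disk_set (Suc m)) g \<and> g ` disk_set (Suc m) \<subseteq> polyhedron K \<and>
             (\<forall>x\<in>sphere_set m. g x = f x)))"
  unfolding k_connected_space_def geometric_realization_eq nsphere_eq ndisk_eq
    continuous_map_subtopology_eu topspace_euclidean_subtopology
  by (auto simp: image_subset_iff_funcset)

text \<open>The m-sphere and its disk lie in the cube of dimension m + 1, so a filling arises by
  extending over the cube and restricting to the disk.\<close>

lemma k_connected_space_if_cube_extensor: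
  assumes "polyhedron K \<noteq> {}" and ext: "\<And>m. int m \<le> k \<Longrightarrow> cube_extensor (Suc m) (polyhedron K)"
  shows "k_connected_space k (geometric_realization K)"
  unfolding k_connected_space_polyhedron_iff
proof (intro conjI allI impI)
  fix m f assume f: "int m \<le> k \<and> continuous_on (sphere_set m) f \<and> f ` sphere_set m \<subseteq> polyhedron K"
  have "sphere_set m \<subseteq> cube (Suc m)"
    using sphere_subset_disk disk_subset_cube by blast
  then obtain g where g: "continuous_on (cube (Suc m)) g" "g ` cube (Suc m) \<subseteq> polyhedron K"
      "\<And>x. x \<in> sphere_set m \<Longrightarrow> g x = f x"
    using cube_extensorE[OF ext closed_sphere_set] f by metis
  then show "\<exists>g. continuous_on (disk_set (Suc m)) g \<and> g ` disk_set (Suc m) \<subseteq> polyhedron K \<and>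
      (\<forall>x\<in>sphere_set m. g x = f x)"
    using continuous_on_subset[OF g(1) disk_subset_cube] image_mono[OF disk_subset_cube, of g "Suc m"]
    by (intro exI[of _ g]) auto
qed (rule assms(1))

text \<open>Applying R to the straight-line contraction of the sphere to the centre of the disk
  gives a null-homotopy of the identity, but the sphere is not contractible.\<close>

lemma no_retraction_disk_sphere:
  assumes R: "continuous_on (disk_set (Suc m)) R" "R ` disk_set (Suc m) \<subseteq> sphere_set m"
    "\<And>x. x \<in> sphere_set m \<Longrightarrow> R x = x"
  shows False
proof -
  define H where "H = (\<lambda>z::real \<times> (nat \<Rightarrow> real). R (\<lambda>i. (1 - fst z) * snd z i))"
  have D: "(\<lambda>i. (1 - fst z) * snd z i) \<in> disk_set (Suc m)" if "z \<in> {0..1} \<times> sphere_set m" for z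
  proof -
    have x: "snd z \<in> sphere_set m" and t: "0 \<le> 1 - fst z" "1 - fst z \<le> 1"
      using that by auto
    have "(\<Sum>i<Suc m. ((1 - fst z) * snd z i)\<^sup>2) = (1 - fst z)\<^sup>2 * (\<Sum>i<Suc m. (snd z i)\<^sup>2)"
      by (simp add: power_mult_distrib sum_distrib_left distrib_left)
    also have "\<dots> = (1 - fst z)\<^sup>2"
      using x by (simp add: sphere_set_def lessThan_Suc_atMost)
    also have "\<dots> \<le> 1"
      using t by (simp add: power_le_one)
    finally show ?thesis
      using x by (simp add: disk_set_def sphere_set_def)
  qed
  have "continuous_on ({0..1} \<times> sphere_set m) (\<lambda>z. snd z i)" for i
    by (rule continuous_on_product_then_coordinatewise) (intro continuous_intros)
  then have "continuous_on ({0..1} \<times> sphere_set m) (\<lambda>z i. (1 - fst z) * snd z i)"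
    by (intro continuous_on_coordinatewise_then_product continuous_intros)
  then have Hc: "continuous_on ({0..1} \<times> sphere_set m) H"
    unfolding H_def by (rule continuous_on_compose2[OF R(1)]) (use D in auto)
  have Hi: "H ` ({0..1} \<times> sphere_set m) \<subseteq> sphere_set m"
    unfolding H_def using R(2) D by blast
  have "homotopic_with (\<lambda>_. True) (nsphere m) (nsphere m) id (\<lambda>_. R (\<lambda>_. 0))"
  proof (subst homotopic_with; (intro exI[of _ H] conjI)?)
    show "continuous_map (prod_topology (top_of_set {0..1}) (nsphere m)) (nsphere m) H"
      using Hc Hi by (auto simp: nsphere_eq)
  qed (use R(3) in \<open>auto simp: H_def nsphere_eq\<close>)
  then have "contractible_space (nsphere m)"
    unfolding contractible_space_def by blast
  then show False
    using non_contractible_space_nsphere by blast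
qed

text \<open>The boundary of a simplex with m + 2 vertices is an m-sphere: h maps the sphere to it,
  and k maps back with \<open>k (h x) = x\<close>. A filling g of h would make
  \<open>k (r (g x))\<close> a retraction of the disk onto the sphere.\<close>

lemma boundary_retract_not_k_connected:
  assumes V: "finite V" "card V = m + 2"
    and r: "continuous_on (polyhedron K) r" "r ` polyhedron K \<subseteq> polyhedron (boundary V)"
      "\<And>t. t \<in> polyhedron (boundary V) \<Longrightarrow> r t = t"
    and K: "boundary V \<subseteq> K"
  shows "\<not> k_connected_space (int m) (geometric_realization K)"
proof
  assume conn: "k_connected_space (int m) (geometric_realization K)"
  obtain idx where idx: "bij_betw idx V {0..<m + 2}"
    using ex_bij_betw_finite_nat[OF V(1)] V(2) by auto
  define e where "e = inv_into V idx"
  have e: "e i \<in> V" "idx (e i) = i" if "i < m + 2" for i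
    using idx that by (auto simp: e_def bij_betw_def inv_into_into f_inv_into_f)
  define h where "h x = recentre V (\<lambda>v. x (idx v))" for x :: "nat \<Rightarrow> real"
  \<comment> \<open>Coordinate \<open>Suc m\<close> of a point of the sphere is 0, so differences
    with it undo the translation in \<open>recentre\<close>; dividing by the norm N undoes the
    scaling.\<close>
  define diff where "diff t i = t (e i) - t (e (Suc m))" for t :: "'a \<Rightarrow> real" and i
  define N where "N t = sqrt (\<Sum>i\<le>m. (diff t i)\<^sup>2)" for t
  define k where "k t = (\<lambda>i. if i \<le> m then diff t i / N t else 0)" for t
  have nd: "\<exists>v\<in>V. \<exists>w\<in>V. x (idx v) \<noteq> x (idx w)" if x: "x \<in> sphere_set m" for x
  proof -
    have "\<exists>i\<le>m. x i \<noteq> 0"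
    proof (rule ccontr)
      assume "\<not> ?thesis"
      then have "(\<Sum>i\<le>m. (x i)\<^sup>2) = 0"
        by simp
      then show False
        using x by (simp add: sphere_set_def)
    qed
    then obtain i where i: "i \<le> m" "x i \<noteq> 0"
      by blast
    moreover have "x (Suc m) = 0"
      using x by (simp add: sphere_set_def)
    ultimately have "x (idx (e i)) \<noteq> x (idx (e (Suc m)))"
      using e(2)[of i] e(2)[of "Suc m"] by simp
    then show ?thesis
      using e(1)[of i] e(1)[of "Suc m"] i by auto
  qed
  have hc: "continuous_on (sphere_set m) h"
    unfolding h_def by (rule continuous_on_recentre[OF V(1) continuous_on_coord nd])
  have hV: "h x \<in> polyhedron (boundary V)" if "x \<in> sphere_set m" for x
    unfolding h_def by (rule recentre_in_boundary[OF V(1) nd[OF that]])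
  have "polyhedron (boundary V) \<subseteq> polyhedron K"
    using K by (auto simp: polyhedron_def)
  then have "h ` sphere_set m \<subseteq> polyhedron K"
    using hV by auto
  then obtain g where g: "continuous_on (disk_set (Suc m)) g" "g ` disk_set (Suc m) \<subseteq> polyhedron K"
      "\<And>x. x \<in> sphere_set m \<Longrightarrow> g x = h x"
    using conn hc unfolding k_connected_space_polyhedron_iff by (metis order_refl)
  have N: "0 < N t" if t: "t \<in> polyhedron (boundary V)" for t
  proof -
    have "\<exists>i\<le>m. diff t i \<noteq> 0"
    proof (rule ccontr)
      assume "\<not> ?thesis"
      then have eq: "t (e i) = t (e (Suc m))" if "i < m + 2" for i
        using that by (cases "i = Suc m") (auto simp: diff_def)
      have "t v = t (e (Suc m))" if "v \<in> V" for v
      proof -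
        have "idx v < m + 2" "e (idx v) = v"
          using idx that by (auto simp: bij_betw_def e_def)
        then show ?thesis
          using eq by metis
      qed
      then show False
        using boundary_not_diagonal[OF V(1) t] by metis
    qed
    then have "0 < (\<Sum>i\<le>m. (diff t i)\<^sup>2)"
      by (auto intro!: sum_pos2)
    then show ?thesis
      by (simp add: N_def)
  qed
  have kc: "continuous_on (polyhedron (boundary V)) k"
  proof (rule continuous_on_coordinatewise_then_product)
    fix i
    have "continuous_on (polyhedron (boundary V)) (\<lambda>t. diff t j)" for j
      unfolding diff_def by (intro continuous_intros continuous_on_coord)
    moreover from this have "continuous_on (polyhedron (boundary V)) N"
      unfolding N_def by (intro continuous_intros)
    moreover have "\<forall>t\<in>polyhedron (boundary V). N t \<noteq> 0"
      using N by (metis less_irrefl)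
    ultimately show "continuous_on (polyhedron (boundary V)) (\<lambda>t. k t i)"
      unfolding k_def by (cases "i \<le> m") (auto intro!: continuous_on_divide)
  qed
  have kS: "k t \<in> sphere_set m" if t: "t \<in> polyhedron (boundary V)" for t
  proof -
    have "(\<Sum>i\<le>m. (k t i)\<^sup>2) = (\<Sum>i\<le>m. (diff t i)\<^sup>2) / (N t)\<^sup>2"
      by (simp add: k_def power_divide sum_divide_distrib)
    also have "(N t)\<^sup>2 = (\<Sum>i\<le>m. (diff t i)\<^sup>2)"
      by (simp add: N_def sum_nonneg)
    also have "(\<Sum>i\<le>m. (diff t i)\<^sup>2) / \<dots> = 1"
      using N[OF t] by (simp add: N_def)
    finally show ?thesis
      by (simp add: sphere_set_def k_def)
  qed
  have kh: "k (h x) = x" if x: "x \<in> sphere_set m" for x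
  proof -
    define s where "s = (\<Sum>v\<in>V. x (idx v) - Min ((\<lambda>v. x (idx v)) ` V))"
    have s: "0 < s"
      unfolding s_def by (rule recentre_denominator_pos[OF V(1) nd[OF x]])
    have xm: "x (Suc m) = 0" and x1: "(\<Sum>i\<le>m. (x i)\<^sup>2) = 1" and x0: "\<And>i. i > m \<Longrightarrow> x i = 0"
      using x by (auto simp: sphere_set_def)
    have d: "diff (h x) i = x i / s" if "i \<le> m" for i
      using that e[of i] e[of "Suc m"] xm
      by (simp add: diff_def h_def recentre_def s_def[symmetric] diff_divide_distrib)
    then have "N (h x) = sqrt ((\<Sum>i\<le>m. (x i)\<^sup>2) / s\<^sup>2)"
      by (simp add: N_def power_divide sum_divide_distrib)
    also have "\<dots> = 1 / s"
      using s x1 by (simp add: real_sqrt_divide)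
    finally show ?thesis
      using s d x0 by (auto simp: k_def)
  qed
  show False
  proof (rule no_retraction_disk_sphere)
    show "continuous_on (disk_set (Suc m)) (\<lambda>x. k (r (g x)))"
      by (rule continuous_on_compose2[OF kc continuous_on_compose2[OF r(1) g(1,2)]]) (use g(2) r(2) in blast)
    show "(\<lambda>x. k (r (g x))) ` disk_set (Suc m) \<subseteq> sphere_set m"
      using g(2) r(2) kS by (blast intro: image_subsetI)
    show "k (r (g x)) = x" if "x \<in> sphere_set m" for x
      using g(3) r(3) hV kh that by simp
  qed
qed

lemma k_connected_space_mono:
  "k_connected_space j X \<Longrightarrow> i \<le> j \<Longrightarrow> k_connected_space i X"
  unfolding k_connected_space_def by force

section \<open>Simplicial maps\<close>

text \<open>The affine extension of a vertex map. A finite U keeps the fibres finite, as a sum over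
  an infinite set is 0 by convention.\<close>

definition simplicial_map :: "'a set \<Rightarrow> ('a \<Rightarrow> 'a) \<Rightarrow> ('a \<Rightarrow> real) \<Rightarrow> 'a \<Rightarrow> real" where
  "simplicial_map U \<phi> t = (\<lambda>w. \<Sum>v | v \<in> U \<and> \<phi> v = w. t v)"

lemma continuous_on_simplicial_map: "continuous_on S (simplicial_map U \<phi>)"
  unfolding simplicial_map_def
  by (intro continuous_on_coordinatewise_then_product continuous_on_sum continuous_on_coord)

lemma simplicial_map_in_polyhedron:
  assumes "finite U" "\<And>\<sigma>. \<sigma> \<in> K \<Longrightarrow> \<sigma> \<subseteq> U" "\<And>\<sigma>. \<sigma> \<in> K \<Longrightarrow> \<phi> ` \<sigma> \<in> L" and t: "t \<in> polyhedron K"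
  shows "simplicial_map U \<phi> t \<in> polyhedron L"
proof -
  let ?s = "simplicial_map U \<phi> t"
  have t0: "0 \<le> t v" for v
    using t by (simp add: polyhedron_def)
  have supp: "{v. t v \<noteq> 0} \<in> K" and t1: "(\<Sum>v | t v \<noteq> 0. t v) = 1"
    using t by (auto simp: polyhedron_def)
  \<comment> \<open>Nonnegative coordinates cannot cancel, so the support of the image point is the
    image of the support.\<close>
  have "?s w \<noteq> 0 \<longleftrightarrow> w \<in> \<phi> ` {v. t v \<noteq> 0}" for w
  proof -
    have "?s w = 0 \<longleftrightarrow> (\<forall>v\<in>{v. v \<in> U \<and> \<phi> v = w}. t v = 0)"
      unfolding simplicial_map_def by (rule sum_nonneg_eq_0_iff) (use assms(1) t0 in auto)
    then show ?thesis
      using assms(2)[OF supp] by blast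
  qed
  then have s_supp: "{w. ?s w \<noteq> 0} = \<phi> ` {v. t v \<noteq> 0}"
    by auto
  have "(\<Sum>w | ?s w \<noteq> 0. ?s w) = (\<Sum>w\<in>\<phi> ` U. ?s w)"
    by (rule sum.mono_neutral_left) (use assms(1) assms(2)[OF supp] s_supp in auto)
  also have "\<dots> = sum t U"
    unfolding simplicial_map_def by (rule sum.image_gen[OF assms(1), symmetric])
  also have "\<dots> = (\<Sum>v | t v \<noteq> 0. t v)"
    by (rule sum.mono_neutral_right) (use assms(1) assms(2)[OF supp] in auto)
  finally have "(\<Sum>w | ?s w \<noteq> 0. ?s w) = 1"
    using t1 by simp
  moreover have "0 \<le> ?s w" for w
    unfolding simplicial_map_def by (intro sum_nonneg t0)
  ultimately show ?thesis
    using s_supp assms(3)[OF supp] by (simp add: polyhedron_def)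
qed

lemma simplicial_map_id:
  assumes "finite U" "\<And>v. v \<in> V \<Longrightarrow> \<phi> v = v" "V \<subseteq> U" "\<And>v. v \<notin> V \<Longrightarrow> t v = 0"
  shows "simplicial_map U \<phi> t = t"
proof
  fix w
  have "t v = 0" if "\<phi> v \<noteq> v" for v
    using assms(2,4) that by metis
  then have "(\<Sum>v | v \<in> U \<and> \<phi> v = w. t v) = (\<Sum>v | v \<in> U \<and> v = w. t v)"
    by (intro sum.mono_neutral_cong) (use assms(1) in \<open>auto, metis\<close>)
  also have "\<dots> = t w"
  proof (cases "w \<in> U")
    case True
    then have "{v. v \<in> U \<and> v = w} = {w}"
      by auto
    then show ?thesis
      by simp
  next
    case False
    then have "{v. v \<in> U \<and> v = w} = {}"
      by auto
    then show ?thesis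
      using False assms by (metis subsetD sum.empty)
  qed
  finally show "simplicial_map U \<phi> t w = t w"
    by (simp add: simplicial_map_def)
qed

text \<open>As all images are proper subsets of V, \<phi> induces a map into the boundary of V. It
  is the identity there, hence a retraction onto an m-sphere.\<close>

lemma simplicial_retract_not_k_connected:
  assumes U: "finite U" "\<And>\<sigma>. \<sigma> \<in> K \<Longrightarrow> \<sigma> \<subseteq> U" and V: "V \<subseteq> U" "card V = m + 2" "boundary V \<subseteq> K"
    and \<phi>: "\<And>v. v \<in> V \<Longrightarrow> \<phi> v = v" "\<And>\<sigma>. \<sigma> \<in> K \<Longrightarrow> \<phi> ` \<sigma> \<subset> V"
    and conn: "k_connected_space j (geometric_realization K)"
  shows "j < int m"
proof (rule ccontr)
  have fV: "finite V"
    using U V finite_subset by blast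
  assume "\<not> j < int m"
  then have "k_connected_space (int m) (geometric_realization K)"
    using conn k_connected_space_mono by force
  moreover have "\<not> k_connected_space (int m) (geometric_realization K)"
  proof (rule boundary_retract_not_k_connected[OF fV V(2) _ _ _ V(3)])
    show "continuous_on (polyhedron K) (simplicial_map U \<phi>)"
      by (rule continuous_on_simplicial_map)
    show "simplicial_map U \<phi> ` polyhedron K \<subseteq> polyhedron (boundary V)"
      using \<phi>(2) by (intro image_subsetI simplicial_map_in_polyhedron[OF U]) auto
    show "simplicial_map U \<phi> t = t" if "t \<in> polyhedron (boundary V)" for t
      using that by (intro simplicial_map_id[OF U(1) \<phi>(1) V(1)]) (auto simp: mem_polyhedron_boundary[OF fV])
  qed
  ultimately show False
    by blast
qed

section \<open>Gluing complexes\<close>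

text \<open>Closedness is carried along since \<open>cube_extensor_Un\<close> asks for closed
  pieces.\<close>

definition complex_extensor :: "nat \<Rightarrow> 'a set set \<Rightarrow> bool" where
  "complex_extensor d K \<longleftrightarrow> cube_extensor d (polyhedron K) \<and> closed (polyhedron K)"

lemma complex_extensor_Pow: "finite V \<Longrightarrow> V \<noteq> {} \<Longrightarrow> complex_extensor d (Pow V)"
  by (simp add: complex_extensor_def cube_extensor_Pow closed_polyhedron_Pow)

lemma complex_extensor_boundary: "finite V \<Longrightarrow> d + 2 \<le> card V \<Longrightarrow> complex_extensor d (boundary V)"
  by (simp add: complex_extensor_def cube_extensor_boundary closed_polyhedron_boundary)

lemma complex_extensor_Un:
  "complex_extensor d K \<Longrightarrow> complex_extensor d L \<Longrightarrow> complex_extensor d (K \<inter> L) \<Longrightarrow>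
    complex_extensor d (K \<union> L)"
  by (auto simp: complex_extensor_def polyhedron_Un polyhedron_Int intro: cube_extensor_Un)

text \<open>A common subset equal to V would put V inside W. Intersections of pieces thus become
  full simplices, which are extensors once they have a vertex.\<close>

lemma boundary_Int_Pow: "\<not> V \<subseteq> W \<Longrightarrow> boundary V \<inter> Pow W = Pow (V \<inter> W)"
  by auto

lemma boundary_Int_boundary: "\<not> V \<subseteq> W \<Longrightarrow> \<not> W \<subseteq> V \<Longrightarrow> boundary V \<inter> boundary W = Pow (V \<inter> W)"
  by auto

section \<open>The graph\<close>

lemma mod_eq_if_abs_less:
  fixes d n :: int
  assumes "\<bar>d\<bar> < n"
  shows "d mod n = (if 0 \<le> d then d else d + n)"
proof (cases "0 \<le> d")
  case False
  then have "(d + n) mod n = d + n"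
    using assms by (intro mod_pos_pos_trivial) auto
  then show ?thesis
    using False by simp
qed (use assms in \<open>simp add: mod_pos_pos_trivial\<close>)

text \<open>The circulant part is the complete bipartite graph on the odd and the even residues without
  the perfect matching that joins antipodal residues.\<close>

lemma circulant_arcs_iff:
  fixes r :: int
  assumes "0 \<le> r"
  shows "(x, y) \<in> circulant_arcs (4 * r + 6) {s. odd s \<and> 1 \<le> s \<and> s \<le> 2 * r + 1} \<longleftrightarrow>
    x \<in> {1..4 * r + 6} \<and> y \<in> {1..4 * r + 6} \<and> odd (x - y) \<and> \<bar>x - y\<bar> \<noteq> 2 * r + 3"
proof (cases "x \<in> {1..4 * r + 6} \<and> y \<in> {1..4 * r + 6}")
  case True
  let ?S = "{s. odd s \<and> 1 \<le> s \<and> s \<le> 2 * r + 1}" and ?n = "4 * r + 6"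
  have S: "z \<in> ?S \<union> (\<lambda>a. ?n - a) ` ?S \<longleftrightarrow> odd z \<and> (1 \<le> z \<and> z \<le> 2 * r + 1 \<or> 2 * r + 5 \<le> z \<and> z \<le> 4 * r + 5)" for z
  proof -
    have "z \<in> (\<lambda>a. ?n - a) ` ?S \<longleftrightarrow> ?n - z \<in> ?S"
      by (auto simp: image_iff intro: exI[of _ "?n - z"])
    then show ?thesis
      by auto
  qed
  \<comment> \<open>Between the blocks S and n - S, that is from 2r + 1 to 2r + 5, the only further
    odd number is 2r + 3.\<close>
  have gap: "odd d \<and> (1 \<le> d \<and> d \<le> 2 * r + 1 \<or> 2 * r + 5 \<le> d \<and> d \<le> 4 * r + 5) \<longleftrightarrow> odd d \<and> d \<noteq> 2 * r + 3"
    if "0 \<le> d" "d < ?n" for d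
  proof (cases "odd d")
    case True
    then obtain k where "d = 2 * k + 1"
      by (rule oddE)
    then show ?thesis
      using that by simp presburger
  qed simp
  have d: "\<bar>x - y\<bar> < ?n"
    using True by auto
  have "(x, y) \<in> circulant_arcs ?n ?S \<longleftrightarrow> (x - y) mod ?n \<in> ?S \<union> (\<lambda>a. ?n - a) ` ?S"
    using True by (simp add: circulant_arcs_def)
  also have "\<dots> \<longleftrightarrow> odd (x - y) \<and> \<bar>x - y\<bar> \<noteq> 2 * r + 3"
  proof (cases "0 \<le> x - y")
    case True
    then show ?thesis
      unfolding S using d gap[of "x - y"] by (simp add: mod_eq_if_abs_less[OF d])
  next
    \<comment> \<open>As n = 2 (2r + 3) is even, adding n preserves parity and sends -(2r + 3) to 2r
      + 3.\<close>
    case False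
    then show ?thesis
      unfolding S using d gap[of "x - y + ?n"] by (auto simp add: mod_eq_if_abs_less[OF d])
  qed
  finally show ?thesis
    using True by simp
qed (auto simp: circulant_arcs_def)

context
  fixes r p :: int
  assumes r: "1 \<le> r" and p: "5 \<le> p"
begin

text \<open>The vertex n + 1, the only vertex of the clique with neighbours in the circulant
  part.\<close>

abbreviation (input) hub :: int where "hub \<equiv> 4 * r + 7"

text \<open>The shift by n / 2 = 2r + 3 modulo n. This number is odd, so the shift exchanges the
  parity classes; it yields the one vertex of the opposite class that is not adjacent.\<close>

definition antipode :: "int \<Rightarrow> int" where
  "antipode v = (if v \<le> 2 * r + 3 then v + (2 * r + 3) else v - (2 * r + 3))"

lemma antipode_iff:
  assumes "1 \<le> v" "v < hub" "1 \<le> w" "w < hub"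
  shows "\<bar>v - w\<bar> = 2 * r + 3 \<longleftrightarrow> w = antipode v"
  using assms by (auto simp: antipode_def abs_if)

lemma parcs_G_graph:
  "(v, w) \<in> parcs (G_graph r p) \<longleftrightarrow>
     (v, w) \<in> circulant_arcs (4 * r + 6) {s. odd s \<and> 1 \<le> s \<and> s \<le> 2 * r + 1}
     \<or> (v, w) \<in> complete_arcs {hub..<hub + p}
     \<or> v = hub \<and> (w = 1 \<or> w = 3) \<or> w = hub \<and> (v = 1 \<or> v = 3)"
proof -
  have "4 * r + 6 + 1 = hub" "{hub..4 * r + 6 + p} = {hub..<hub + p}"
    by auto
  then have "parcs (G_graph r p) =
      circulant_arcs (4 * r + 6) {s. odd s \<and> 1 \<le> s \<and> s \<le> 2 * r + 1} \<union> complete_arcs {hub..<hub + p}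
      \<union> {(hub, 1), (1, hub), (hub, 3), (3, hub)}"
    by (simp only: G_graph_def Let_def pair_pre_digraph.select_convs)
  then show ?thesis
    by blast
qed

lemma arc_low:
  assumes "1 \<le> v" "v < hub"
  shows "(v, w) \<in> parcs (G_graph r p) \<longleftrightarrow>
    1 \<le> w \<and> w < hub \<and> odd (v - w) \<and> w \<noteq> antipode v \<or> w = hub \<and> (v = 1 \<or> v = 3)"
proof -
  have "(v, w) \<in> circulant_arcs (4 * r + 6) {s. odd s \<and> 1 \<le> s \<and> s \<le> 2 * r + 1} \<longleftrightarrow>
      1 \<le> w \<and> w < hub \<and> odd (v - w) \<and> \<bar>v - w\<bar> \<noteq> 2 * r + 3"
    using r assms circulant_arcs_iff[of r v w] by auto
  moreover have "(v, w) \<notin> complete_arcs {hub..<hub + p}" "v \<noteq> hub"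
    using assms by (auto simp: complete_arcs_def)
  ultimately show ?thesis
    using antipode_iff[OF assms, of w] unfolding parcs_G_graph by blast
qed

lemma arc_high:
  assumes "hub \<le> v" "v < hub + p"
  shows "(v, w) \<in> parcs (G_graph r p) \<longleftrightarrow>
    hub \<le> w \<and> w < hub + p \<and> w \<noteq> v \<or> v = hub \<and> (w = 1 \<or> w = 3)"
proof -
  have "(v, w) \<notin> circulant_arcs (4 * r + 6) {s. odd s \<and> 1 \<le> s \<and> s \<le> 2 * r + 1}" "v \<noteq> 1" "v \<noteq> 3"
    using assms r by (auto simp: circulant_arcs_def)
  moreover have "(v, w) \<in> complete_arcs {hub..<hub + p} \<longleftrightarrow> hub \<le> w \<and> w < hub + p \<and> w \<noteq> v"
    using assms by (auto simp: complete_arcs_def)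
  ultimately show ?thesis
    unfolding parcs_G_graph by blast
qed

lemma verts_G_graph: "v \<in> pverts (G_graph r p) \<longleftrightarrow> 1 \<le> v \<and> v < hub + p"
  by (auto simp: G_graph_def Let_def)

text \<open>Within the opposite parity class a vertex misses only its antipode, which cannot be both
  a and a + 2.\<close>

lemma arc_one_of_two:
  assumes "1 \<le> u" "u < hub" "1 \<le> a" "a + 2 < hub" "odd (u - a)"
  shows "\<exists>w\<in>{a, a + 2}. (u, w) \<in> parcs (G_graph r p)"
proof -
  have "odd (u - (a + 2))"
    using assms(5) by simp
  moreover have "a \<noteq> antipode u \<or> a + 2 \<noteq> antipode u"
    by auto
  ultimately show ?thesis
    using assms arc_low[OF assms(1,2)] by auto
qed

section \<open>Stiffness: a neighbour of u that is no neighbour of v\<close>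

lemma stiff_G_graph: "stiff (G_graph r p)"
  unfolding stiff_def
proof (intro notI, elim bexE conjE)
  fix u v assume u: "u \<in> pverts (G_graph r p)" and v: "v \<in> pverts (G_graph r p)" and "u \<noteq> v"
    and sub: "nbrs (G_graph r p) u \<subseteq> nbrs (G_graph r p) v"
  let ?A = "\<lambda>a b. (a, b) \<in> parcs (G_graph r p)"
  have no: False if "?A u w" "\<not> ?A v w" for w
    using sub that by (auto simp: nbrs_def)
  have low: "1 \<le> u" "1 \<le> v" and high: "u < hub + p" "v < hub + p"
    using u v by (auto simp: verts_G_graph)
  consider "hub \<le> u" "hub \<le> v" | "hub \<le> u" "v < hub" | "u < hub" "hub \<le> v"
    | "u < hub" "v < hub" "odd (u - v)" | "u < hub" "v < hub" "even (u - v)"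
    by linarith
  then show False
  proof cases
    case 1
    then have "?A u v" "\<not> ?A v v"
      using arc_high[OF 1(1) high(1)] arc_high[OF 1(2) high(2)] \<open>u \<noteq> v\<close> high r by auto
    then show False
      by (rule no)
  next
    case 2
    \<comment> \<open>Clique vertices beyond the hub have no neighbours in the circulant part; the
      case distinction keeps w different from u.\<close>
    define w where "w = (if u = hub + 1 then hub + 2 else hub + 1)"
    have "?A u w" "\<not> ?A v w"
      using arc_high[OF 2(1) high(1)] arc_low[OF low(2) 2(2)] p by (auto simp: w_def)
    then show False
      by (rule no)
  next
    case 3
    \<comment> \<open>Among the circulant vertices only 1 and 3 have neighbours in the clique. The
      pairs 2, 4 and 5, 7 avoid both, and one member is adjacent to u.\<close>
    define a where "a = (if odd u then 2 else 5 :: int)"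
    have a: "1 \<le> a" "a + 2 < hub" "odd (u - a)" "a \<notin> {1, 3}" "a + 2 \<notin> {1, 3}"
      using r by (auto simp: a_def)
    then obtain w where w: "w \<in> {a, a + 2}" "?A u w"
      using arc_one_of_two[OF low(1) 3(1) a(1-3)] by blast
    then have "w < hub" "w \<notin> {1, 3}"
      using a by auto
    then have "\<not> ?A v w"
      using arc_high[OF 3(2) high(2), of w] by auto
    with w(2) show False
      by (rule no)
  next
    case 4
    \<comment> \<open>Both a and a + 2 have the parity of v, so neither is adjacent to v; the case
      distinction keeps them in range.\<close>
    define a where "a = (if v \<le> 2 then v else v - 2)"
    have a: "1 \<le> a" "a + 2 < hub" "even (v - a)"
      using low 4 r by (auto simp: a_def)
    then have "odd (u - a)"
      using 4(3) by presburger
    then obtain w where w: "w \<in> {a, a + 2}" "?A u w"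
      using arc_one_of_two[OF low(1) 4(1) a(1,2)] by blast
    then have "even (v - w)" "w \<noteq> hub"
      using a by auto
    then have "\<not> ?A v w"
      using arc_low[OF low(2) 4(2)] by blast
    with w(2) show False
      by (rule no)
  next
    case 5
    \<comment> \<open>For equal parity, the antipode of v is missed by v but not by u, whose
      antipode is a different vertex.\<close>
    let ?w = "antipode v"
    have w: "1 \<le> ?w" "?w < hub"
      using low 5 r by (auto simp: antipode_def)
    have "odd (v - ?w)"
      by (simp add: antipode_def)
    then have "odd (u - ?w)"
      using 5(3) by presburger
    moreover have "?w \<noteq> antipode u"
      using \<open>u \<noteq> v\<close> low 5 by (auto simp: antipode_def split: if_splits)
    ultimately have "?A u ?w" "\<not> ?A v ?w"
      using arc_low[OF low(1) 5(1), of ?w] arc_low[OF low(2) 5(2), of ?w] w by auto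
    then show False
      by (rule no)
  qed
qed

section \<open>Vertex connectivity: the hub as a cut vertex\<close>

lemma hub_in_vwalk:
  assumes "vwalk q (with_proj (G_graph r p))" "hd q < hub" "hub \<le> last q"
  shows "hub \<in> set q"
  using assms
proof (induction q rule: vwalk_induct)
  case (Cons u v es)
  then show ?case
  proof (cases "v < hub")
    case False
    moreover have "1 \<le> u"
      using Cons.hyps(1) r unfolding with_proj_simps parcs_G_graph by (auto simp: circulant_arcs_def complete_arcs_def)
    \<comment> \<open>An arc that leaves the circulant part can only end at the hub.\<close>
    ultimately have "v = hub"
      using arc_low[of u v] Cons by auto
    then show ?thesis
      by simp
  qed auto
qed auto

lemma has_vertex_connectivity_G_graph: "has_vertex_connectivity (G_graph r p) 1"
proof -
  interpret pair_graph "G_graph r p"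
    by (rule pair_graph_G_graph) (use r p in auto)
  let ?G = "with_proj (G_graph r p)"
  let ?A = "\<lambda>a b. (a, b) \<in> parcs (G_graph r p)"
  have arc: "a \<rightarrow>\<^sup>*\<^bsub>?G\<^esub> b" if "?A a b" for a b
    using that by (intro reachable_adjI) simp
  have sym: "?A a b \<Longrightarrow> ?A b a" for a b
    using arcs_symmetric by simp
  \<comment> \<open>Reachability is directed, so both directions are carried along. The hub is
    joined to 1, 3 and the rest of the clique, each even vertex to 1 or 3, and each odd vertex to 2
    or 4.\<close>
  have to_hub: "v \<rightarrow>\<^sup>*\<^bsub>?G\<^esub> hub \<and> hub \<rightarrow>\<^sup>*\<^bsub>?G\<^esub> v" if "v \<in> pverts (G_graph r p)" for v
  proof -
    have step: "a \<rightarrow>\<^sup>*\<^bsub>?G\<^esub> hub \<and> hub \<rightarrow>\<^sup>*\<^bsub>?G\<^esub> a" if "?A a b" "b \<rightarrow>\<^sup>*\<^bsub>?G\<^esub> hub \<and> hub \<rightarrow>\<^sup>*\<^bsub>?G\<^esub> b" for a b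
      using that arc sym by (meson reachable_trans)
    have hub: "hub \<rightarrow>\<^sup>*\<^bsub>?G\<^esub> hub \<and> hub \<rightarrow>\<^sup>*\<^bsub>?G\<^esub> hub"
      using r p by (simp add: verts_G_graph)
    have one: "b \<rightarrow>\<^sup>*\<^bsub>?G\<^esub> hub \<and> hub \<rightarrow>\<^sup>*\<^bsub>?G\<^esub> b" if "b = 1 \<or> b = 3" for b
      by (rule step[OF _ hub]) (use that r arc_low[of b hub] in auto)
    have even: "v \<rightarrow>\<^sup>*\<^bsub>?G\<^esub> hub \<and> hub \<rightarrow>\<^sup>*\<^bsub>?G\<^esub> v" if "even v" "1 \<le> v" "v < hub" for v
    proof -
      have "\<exists>w\<in>{1, 1 + 2}. ?A v w"
        by (rule arc_one_of_two) (use that r in auto)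
      then obtain w where w: "w \<in> {1, 1 + 2}" "?A v w"
        by blast
      show ?thesis
        by (rule step[OF w(2) one]) (use w(1) in auto)
    qed
    have odd: "v \<rightarrow>\<^sup>*\<^bsub>?G\<^esub> hub \<and> hub \<rightarrow>\<^sup>*\<^bsub>?G\<^esub> v" if "odd v" "1 \<le> v" "v < hub" for v
    proof -
      have "\<exists>w\<in>{2, 2 + 2}. ?A v w"
        by (rule arc_one_of_two) (use that r in auto)
      then obtain w where w: "w \<in> {2, 2 + 2}" "?A v w"
        by blast
      show ?thesis
        by (rule step[OF w(2) even]) (use w(1) r in auto)
    qed
    consider "v < hub" "even v" | "v < hub" "odd v" | "v = hub" | "hub < v"
      by linarith
    then show ?thesis
    proof cases
      case 4
      then show ?thesis
        using that p arc_high[of v hub] by (intro step[OF _ hub]) (simp add: verts_G_graph)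
    qed (use that even odd hub in \<open>auto simp: verts_G_graph\<close>)
  qed
  have "joined_by_disjoint_paths (G_graph r p) 1 x y"
    if "x \<in> pverts (G_graph r p)" "y \<in> pverts (G_graph r p)" for x y
  proof -
    have "x \<rightarrow>\<^sup>*\<^bsub>?G\<^esub> y"
      using to_hub that by (meson reachable_trans)
    then obtain q where "vpath q ?G" "hd q = x" "last q = y"
      using reachable_vpath_conv by blast
    then show ?thesis
      unfolding joined_by_disjoint_paths_def by (intro exI[of _ "{q}"]) simp
  qed
  then have "all_pairs_joined (G_graph r p) 1"
    by (simp add: all_pairs_joined_def)
  moreover have "j \<le> 1" if "all_pairs_joined (G_graph r p) j" for j
  proof (rule ccontr)
    assume "\<not> j \<le> 1"
    \<comment> \<open>The vertices 2 and hub + 1 lie on different sides of the hub, so any two paths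
      between them share it as an inner vertex.\<close>
    have "joined_by_disjoint_paths (G_graph r p) j 2 (hub + 1)"
      using that r p by (simp add: all_pairs_joined_def verts_G_graph)
    then obtain P where P: "finite P" "j \<le> card P"
        "\<And>q. q \<in> P \<Longrightarrow> vpath q ?G \<and> hd q = 2 \<and> last q = hub + 1"
        "\<And>q q'. q \<in> P \<Longrightarrow> q' \<in> P \<Longrightarrow> q \<noteq> q' \<Longrightarrow> set q \<inter> set q' = {2, hub + 1}"
      unfolding joined_by_disjoint_paths_def by metis
    have "\<not> card P \<le> Suc 0"
      using P(2) \<open>\<not> j \<le> 1\<close> by simp
    then obtain q q' where q: "q \<in> P" "q' \<in> P" "q \<noteq> q'"
      using card_le_Suc0_iff_eq[OF P(1)] by blast
    have "hub \<in> set q" "hub \<in> set q'"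
      using hub_in_vwalk P(3)[OF q(1)] P(3)[OF q(2)] r by (auto simp: vpath_def)
    then have "hub \<in> {2, hub + 1}"
      using P(4)[OF q] by blast
    then show False
      using r by simp
  qed
  ultimately show ?thesis
    by (auto simp: has_vertex_connectivity_def)
qed

section \<open>Its neighbourhood complex\<close>

definition "odd_part = {v. odd v \<and> 1 \<le> v \<and> v < hub}"
definition "even_part = {v. even v \<and> 1 \<le> v \<and> v < hub}"
definition "clique = {hub..<hub + p}"
text \<open>The neighbourhood of the hub. It meets the odd sphere in the edge on 1 and 3, and the
  clique sphere in the facet opposite the hub.\<close>

definition "bridge = {1, 3} \<union> {hub + 1..<hub + p}"
text \<open>For a = 1 and a = 3 this is the neighbourhood of a: a facet of the even sphere, omitting
  the antipode of a, with the hub added.\<close>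

definition "fan a = insert hub (even_part - {a + (2 * r + 3)})" for a

lemma antipode:
  "v \<in> odd_part \<Longrightarrow> antipode v \<in> even_part" "v \<in> even_part \<Longrightarrow> antipode v \<in> odd_part"
  "v \<in> odd_part \<Longrightarrow> antipode (antipode v) = v" "v \<in> even_part \<Longrightarrow> antipode (antipode v) = v"
  by (auto simp: antipode_def odd_part_def even_part_def)

lemma nbrs_even_part:
  assumes "v \<in> even_part"
  shows "nbrs (G_graph r p) v = odd_part - {antipode v}"
proof -
  have "1 \<le> v" "v < hub" "even v" "v \<noteq> 1" "v \<noteq> 3"
    using assms by (auto simp: even_part_def)
  then show ?thesis
    using arc_low[of v] unfolding nbrs_def odd_part_def by auto
qed

lemma nbrs_odd_part:
  assumes "v \<in> odd_part" "v \<noteq> 1" "v \<noteq> 3"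
  shows "nbrs (G_graph r p) v = even_part - {antipode v}"
proof -
  have "1 \<le> v" "v < hub" "odd v"
    using assms by (auto simp: odd_part_def)
  then show ?thesis
    using assms(2,3) arc_low[of v] unfolding nbrs_def even_part_def by auto
qed

lemma nbrs_1_3:
  assumes "a = 1 \<or> a = 3"
  shows "nbrs (G_graph r p) a = fan a"
proof -
  have "1 \<le> a" "a < hub" "odd a" "antipode a = a + (2 * r + 3)"
    using assms r by (auto simp: antipode_def)
  then show ?thesis
    using assms arc_low[of a] unfolding nbrs_def even_part_def fan_def by auto
qed

lemma nbrs_hub: "nbrs (G_graph r p) hub = bridge"
proof (rule Set.set_eqI)
  fix w
  have "(hub, w) \<in> parcs (G_graph r p) \<longleftrightarrow> hub \<le> w \<and> w < hub + p \<and> w \<noteq> hub \<or> w = 1 \<or> w = 3"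
    using p arc_high[of hub w] by simp
  also have "\<dots> \<longleftrightarrow> w \<in> bridge"
    unfolding bridge_def by auto
  finally show "w \<in> nbrs (G_graph r p) hub \<longleftrightarrow> w \<in> bridge"
    by (simp add: nbrs_def)
qed

lemma nbrs_clique:
  assumes "v \<in> clique" "v \<noteq> hub"
  shows "nbrs (G_graph r p) v = clique - {v}"
proof (rule Set.set_eqI)
  fix w
  show "w \<in> nbrs (G_graph r p) v \<longleftrightarrow> w \<in> clique - {v}"
    using assms arc_high[of v w] by (auto simp: nbrs_def clique_def)
qed

lemma pverts_G_graph: "pverts (G_graph r p) = odd_part \<union> even_part \<union> clique"
  using r p by (auto simp: verts_G_graph odd_part_def even_part_def clique_def)

lemma fan_eq: "a = 1 \<or> a = 3 \<Longrightarrow> fan a = insert hub (even_part - {antipode a})"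
  using r by (auto simp: fan_def antipode_def)

lemma neighbourhood_complex_eq_UN:
  "neighbourhood_complex (G_graph r p) = (\<Union>v\<in>pverts (G_graph r p). Pow (nbrs (G_graph r p) v))"
proof -
  have "nbrs (G_graph r p) v \<subseteq> pverts (G_graph r p)" for v
  proof -
    interpret pair_graph "G_graph r p"
      by (rule pair_graph_G_graph) (use r p in auto)
    show ?thesis
      using in_arcsD2 by (auto simp: nbrs_def)
  qed
  then show ?thesis
    unfolding neighbourhood_complex_def by blast
qed

text \<open>A vertex of one parity class misses one vertex of the other, so the neighbourhoods are
  the facets of the two boundaries, except that those of 1 and 3 gain the hub. The clique vertices
  beyond the hub give every facet of the clique boundary but the one opposite the hub, which lies in
  the bridge. The union is written in the order of gluing.\<close>

lemma neighbourhood_complex_G_graph: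
  "neighbourhood_complex (G_graph r p) =
     boundary odd_part \<union> Pow bridge \<union> boundary clique \<union> (Pow (fan 1) \<union> Pow (fan 3)) \<union> boundary even_part"
  (is "_ = ?R")
proof
  have in13: "1 \<in> odd_part" "3 \<in> odd_part" "hub \<in> clique"
    using r p by (auto simp: odd_part_def clique_def)
  show "neighbourhood_complex (G_graph r p) \<subseteq> ?R"
  proof
    fix \<sigma> assume "\<sigma> \<in> neighbourhood_complex (G_graph r p)"
    then obtain v where v: "v \<in> odd_part \<union> even_part \<union> clique" "\<sigma> \<subseteq> nbrs (G_graph r p) v"
      by (auto simp: neighbourhood_complex_eq_UN pverts_G_graph)
    consider "v \<in> even_part" | "v = 1 \<or> v = 3" | "v \<in> odd_part" "v \<noteq> 1" "v \<noteq> 3" | "v = hub"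
      | "v \<in> clique" "v \<noteq> hub"
      using v(1) by blast
    then show "\<sigma> \<in> ?R"
    proof cases
      case 1
      then show ?thesis
        using v(2) nbrs_even_part[OF 1] antipode(2)[OF 1] by blast
    next
      case 2
      then show ?thesis
        using v(2) nbrs_1_3[OF 2] by blast
    next
      case 3
      then show ?thesis
        using v(2) nbrs_odd_part[OF 3] antipode(1)[OF 3(1)] by blast
    next
      case 4
      then show ?thesis
        using v(2) nbrs_hub by blast
    next
      case 5
      then show ?thesis
        using v(2) nbrs_clique[OF 5] by blast
    qed
  qed
  have mem: "\<sigma> \<in> neighbourhood_complex (G_graph r p)"
    if "\<sigma> \<subseteq> nbrs (G_graph r p) v" "v \<in> odd_part \<union> even_part \<union> clique" for \<sigma> v
    using that unfolding neighbourhood_complex_eq_UN pverts_G_graph by blast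
  show "?R \<subseteq> neighbourhood_complex (G_graph r p)"
  proof
    fix \<sigma> assume "\<sigma> \<in> ?R"
    then consider "\<sigma> \<subset> odd_part" | "\<sigma> \<subseteq> bridge" | "\<sigma> \<subset> clique" | a where "\<sigma> \<subseteq> fan a" "a = 1 \<or> a = 3"
      | "\<sigma> \<subset> even_part"
      by blast
    then show "\<sigma> \<in> neighbourhood_complex (G_graph r p)"
    proof cases
      case 1
      then obtain w where w: "w \<in> odd_part" "w \<notin> \<sigma>"
        by blast
      have "nbrs (G_graph r p) (antipode w) = odd_part - {w}"
        using nbrs_even_part[OF antipode(1)[OF w(1)]] antipode(3)[OF w(1)] by simp
      then show ?thesis
        using 1 w antipode(1)[OF w(1)] by (intro mem[of _ "antipode w"]) auto
    next
      case 2
      then show ?thesis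
        using in13 by (intro mem[of _ hub]) (auto simp: nbrs_hub)
    next
      case 3
      then obtain w where w: "w \<in> clique" "w \<notin> \<sigma>"
        by blast
      show ?thesis
      proof (cases "w = hub")
        case True
        have "clique - {hub} \<subseteq> bridge"
          by (auto simp: clique_def bridge_def)
        then have "\<sigma> \<subseteq> bridge"
          using w 3 True by blast
        then show ?thesis
          using in13 by (intro mem[of _ hub]) (auto simp: nbrs_hub)
      next
        case False
        then show ?thesis
          using w 3 by (intro mem[of _ w]) (auto simp: nbrs_clique)
      qed
    next
      case 4
      then show ?thesis
        using in13 nbrs_1_3[OF 4(2)] by (intro mem[of _ a]) auto
    next
      case 5
      then obtain w where w: "w \<in> even_part" "w \<notin> \<sigma>"
        by blast
      let ?a = "antipode w"
      have a: "?a \<in> odd_part" "antipode ?a = w"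
        using antipode(2,4)[OF w(1)] by auto
      have "even_part - {w} \<subseteq> nbrs (G_graph r p) ?a"
      proof (cases "?a = 1 \<or> ?a = 3")
        case True
        then show ?thesis
          using nbrs_1_3[OF True] fan_eq[OF True] a(2) by auto
      next
        case False
        then show ?thesis
          using nbrs_odd_part[OF a(1)] a(2) by auto
      qed
      then show ?thesis
        using 5 w a by (intro mem[of _ ?a]) auto
    qed
  qed
qed

section \<open>Sizes of the pieces and the lower bound for Conn by gluing\<close>

lemma card_odd_part: "card odd_part = nat (2 * r + 3)"
proof -
  have "odd_part = (\<lambda>i. 2 * i + 1) ` {0..<2 * r + 3}"
  proof (rule Set.set_eqI)
    fix v
    show "v \<in> odd_part \<longleftrightarrow> v \<in> (\<lambda>i. 2 * i + 1) ` {0..<2 * r + 3}"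
      unfolding odd_part_def image_iff Bex_def atLeastLessThan_iff mem_Collect_eq by presburger
  qed
  moreover have "inj_on (\<lambda>i::int. 2 * i + 1) {0..<2 * r + 3}"
    by (auto simp: inj_on_def)
  ultimately show ?thesis
    by (simp add: card_image)
qed

lemma card_even_part: "card even_part = nat (2 * r + 3)"
proof -
  have "even_part = (\<lambda>i. 2 * i + 2) ` {0..<2 * r + 3}"
  proof (rule Set.set_eqI)
    fix v
    show "v \<in> even_part \<longleftrightarrow> v \<in> (\<lambda>i. 2 * i + 2) ` {0..<2 * r + 3}"
      unfolding even_part_def image_iff Bex_def atLeastLessThan_iff mem_Collect_eq by presburger
  qed
  moreover have "inj_on (\<lambda>i::int. 2 * i + 2) {0..<2 * r + 3}"
    by (auto simp: inj_on_def)
  ultimately show ?thesis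
    by (simp add: card_image)
qed

lemma card_clique: "card clique = nat p"
  by (simp add: clique_def)

lemma finite_parts: "finite odd_part" "finite even_part" "finite clique" "finite bridge" "finite (fan a)"
proof -
  show fe: "finite odd_part" "finite even_part"
    by (rule finite_subset[of _ "{1..hub}"]; auto simp: odd_part_def even_part_def)+
  show "finite clique" "finite bridge" "finite (fan a)"
    using fe by (auto simp: clique_def bridge_def fan_def)
qed

lemma part_intersections:
  "odd_part \<inter> even_part = {}" "odd_part \<inter> clique = {}" "even_part \<inter> clique = {}"
  "odd_part \<inter> bridge = {1, 3}" "even_part \<inter> bridge = {}" "clique \<inter> bridge = {hub + 1..<hub + p}"
  "hub \<in> clique" "hub \<notin> bridge" "5 \<in> odd_part"
  using r p by (auto simp: odd_part_def even_part_def clique_def bridge_def fan_def)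

text \<open>The bounds on d make the three boundaries extensors. The pieces are glued from left to
  right, and each new one meets the earlier ones in an extensor: the edge on 1 and 3, the simplex on
  \<open>clique \<inter> bridge\<close>, the point hub, and the traces of the fans on the even
  vertices.\<close>

lemma complex_extensor_neighbourhood_complex:
  assumes "int d \<le> 2 * r + 1" "int d \<le> p - 2"
  shows "complex_extensor d (neighbourhood_complex (G_graph r p))"
proof -
  let ?O = "boundary odd_part" and ?E = "boundary even_part" and ?C = "boundary clique"
  have bd: "complex_extensor d ?O" "complex_extensor d ?E" "complex_extensor d ?C"
  proof -
    have "d + 2 \<le> nat (2 * r + 3)" "d + 2 \<le> nat p"
      using assms r p by linarith+
    then show "complex_extensor d ?O" "complex_extensor d ?E" "complex_extensor d ?C"
      using finite_parts by (simp_all add: complex_extensor_boundary card_odd_part card_even_part card_clique)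
  qed
  have pw: "complex_extensor d (Pow V)" if "finite V" "v \<in> V" for V :: "int set" and v
    using that by (intro complex_extensor_Pow) auto
  have fan: "fan a \<subseteq> insert hub even_part" "hub \<in> fan a" for a
    by (auto simp: fan_def)
  have two: "2 \<in> fan a" "2 \<in> even_part" "a + (2 * r + 3) \<in> even_part - fan a" if "a = 1 \<or> a = 3" for a
    using that r by (auto simp: fan_def even_part_def)
  have ne: "5 \<in> odd_part - bridge" "hub \<in> clique - bridge" "hub + 1 \<in> clique"
    using r p by (auto simp: odd_part_def bridge_def clique_def)
  note dis = part_intersections
  have OB: "?O \<inter> Pow bridge = Pow {1, 3}"
    using ne(1) dis(4) by (subst boundary_Int_Pow) auto
  have 1: "complex_extensor d (?O \<union> Pow bridge)"
  proof (rule complex_extensor_Un)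
    show "complex_extensor d (Pow bridge)"
      by (rule pw[of _ 1]) (auto simp: finite_parts bridge_def)
    show "complex_extensor d (?O \<inter> Pow bridge)"
      unfolding OB by (rule pw[of _ 1]) auto
  qed (rule bd)
  \<comment> \<open>These pieces share only the empty simplex, which contributes no point and is
    absorbed by the nonempty intersections.\<close>
  have OC: "?O \<inter> ?C = Pow {}" and CE: "?C \<inter> ?E = Pow {}" and OE: "?O \<inter> ?E = Pow {}"
    using ne dis(1-3) two(2)[of 1] by (subst boundary_Int_boundary; auto)+
  have BC: "Pow bridge \<inter> ?C = Pow (clique \<inter> bridge)"
    using ne(2) by (subst Int_commute, intro boundary_Int_Pow) auto
  have "(?O \<union> Pow bridge) \<inter> ?C = Pow (clique \<inter> bridge)"
    unfolding Int_Un_distrib2 OC BC by auto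
  then have 2: "complex_extensor d (?O \<union> Pow bridge \<union> ?C)"
    using pw[of "clique \<inter> bridge" "hub + 1"] finite_parts p
    by (intro complex_extensor_Un 1 bd) (simp add: dis(6))
  \<comment> \<open>Two simplices with a common vertex v. With V = UNIV and v = hub these are the
    fans; with V = \<open>even_part\<close> and v = 2, their traces on the even sphere.\<close>
  have FF: "complex_extensor d (Pow (fan 1 \<inter> V) \<union> Pow (fan 3 \<inter> V))" if "v \<in> fan 1 \<inter> fan 3 \<inter> V" for v V
  proof (rule complex_extensor_Un)
    show "complex_extensor d (Pow (fan 1 \<inter> V))" "complex_extensor d (Pow (fan 3 \<inter> V))"
      by (rule pw[of _ v]; use that finite_parts in auto)+
    show "complex_extensor d (Pow (fan 1 \<inter> V) \<inter> Pow (fan 3 \<inter> V))"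
      unfolding Pow_Int_eq[symmetric] by (rule pw[of _ v]) (use that finite_parts in auto)
  qed
  have 3: "complex_extensor d (Pow (fan 1) \<union> Pow (fan 3))"
    using FF[of hub UNIV] fan(2) by simp
  have OF: "?O \<inter> Pow (fan a) = Pow {}" and BF: "Pow bridge \<inter> Pow (fan a) = Pow {}"
    and CF: "?C \<inter> Pow (fan a) = Pow {hub}" for a
  proof -
    have *: "odd_part \<inter> fan a = {}" "bridge \<inter> fan a = {}" "clique \<inter> fan a = {hub}"
      using fan[of a] dis(1-3,5,7,8) by blast+
    moreover have "hub + 1 \<notin> {hub}"
      by simp
    ultimately have nO: "\<not> odd_part \<subseteq> fan a" and nC: "\<not> clique \<subseteq> fan a"
      using ne by blast+
    show "?O \<inter> Pow (fan a) = Pow {}"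
      unfolding boundary_Int_Pow[OF nO] *(1) ..
    show "Pow bridge \<inter> Pow (fan a) = Pow {}"
      unfolding Pow_Int_eq[symmetric] *(2) ..
    show "?C \<inter> Pow (fan a) = Pow {hub}"
      unfolding boundary_Int_Pow[OF nC] *(3) ..
  qed
  have "(?O \<union> Pow bridge \<union> ?C) \<inter> (Pow (fan 1) \<union> Pow (fan 3)) = Pow {hub}"
    unfolding Int_Un_distrib2 Int_Un_distrib OF BF CF by auto
  then have 4: "complex_extensor d (?O \<union> Pow bridge \<union> ?C \<union> (Pow (fan 1) \<union> Pow (fan 3)))"
    using pw[of "{hub}" hub] by (intro complex_extensor_Un 2 3) simp
  have FE: "Pow (fan a) \<inter> ?E = Pow (fan a \<inter> even_part)" if "a = 1 \<or> a = 3" for a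
    unfolding Int_commute[of _ ?E] Int_commute[of _ even_part]
    by (rule boundary_Int_Pow) (use two(3)[OF that] in auto)
  have BE: "Pow bridge \<inter> ?E = Pow {}"
    unfolding Int_commute[of _ ?E] using dis(5) two(2)[of 1] by (subst boundary_Int_Pow) auto
  have "(?O \<union> Pow bridge \<union> ?C \<union> (Pow (fan 1) \<union> Pow (fan 3))) \<inter> ?E =
      Pow (fan 1 \<inter> even_part) \<union> Pow (fan 3 \<inter> even_part)"
    unfolding Int_Un_distrib2 OE BE CE by (simp add: FE insert_absorb)
  then have "complex_extensor d (?O \<union> Pow bridge \<union> ?C \<union> (Pow (fan 1) \<union> Pow (fan 3)) \<union> ?E)"
    using FF[of 2 even_part] two[of 1] two[of 3] by (intro complex_extensor_Un 4 bd) simp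
  then show ?thesis
    by (simp only: neighbourhood_complex_G_graph)
qed

section \<open>Upper bounds for Conn by simplicial retractions\<close>

lemma neighbourhood_complex_cases:
  assumes "\<sigma> \<in> neighbourhood_complex (G_graph r p)"
  obtains "\<sigma> \<subset> odd_part" | "\<sigma> \<subseteq> bridge" | "\<sigma> \<subset> clique" | "\<sigma> \<subseteq> insert hub even_part"
  \<comment> \<open>The fans and the even boundary share the last case, since each retraction below
    is constant on the even vertices and the hub.\<close>
  using assms unfolding neighbourhood_complex_G_graph fan_def by blast

text \<open>All vertices off the odd part are sent to 1. Simplices of the other pieces meet the odd
  part at most in 1 and 3, so their images miss 5 and are proper.\<close>

lemma k_connected_less_odd_part:
  assumes "k_connected_space j (geometric_realization (neighbourhood_complex (G_graph r p)))"
  shows "j < 2 * r + 1"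
proof -
  define \<phi> where "\<phi> v = (if v \<in> odd_part then v else 1)" for v
  have outside: "\<phi> ` \<sigma> \<subset> odd_part" if "\<sigma> \<inter> odd_part \<subseteq> {1, 3}" for \<sigma>
  proof -
    have "\<phi> ` \<sigma> \<subseteq> {1, 3}"
    proof (rule image_subsetI)
      fix v assume "v \<in> \<sigma>"
      then show "\<phi> v \<in> {1, 3}"
        using that by (cases "v \<in> odd_part") (auto simp: \<phi>_def)
    qed
    moreover have "{1, 3} \<subseteq> odd_part" "5 \<in> odd_part" "5 \<notin> {1, 3 :: int}"
      using part_intersections(4,9) by auto
    ultimately show ?thesis
      by blast
  qed
  have "j < int (nat (2 * r + 1))"
  proof (rule simplicial_retract_not_k_connected[OF _ _ _ _ _ _ _ assms])
    show "finite (pverts (G_graph r p))"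
      using finite_parts by (simp add: pverts_G_graph)
    show "\<sigma> \<subseteq> pverts (G_graph r p)" if "\<sigma> \<in> neighbourhood_complex (G_graph r p)" for \<sigma>
      using that by (simp add: neighbourhood_complex_def)
    show "odd_part \<subseteq> pverts (G_graph r p)"
      by (auto simp: pverts_G_graph)
    show "card odd_part = nat (2 * r + 1) + 2"
      using r by (simp add: card_odd_part)
    show "boundary odd_part \<subseteq> neighbourhood_complex (G_graph r p)"
      by (auto simp: neighbourhood_complex_G_graph)
    show "\<phi> v = v" if "v \<in> odd_part" for v
      using that by (simp add: \<phi>_def)
    fix \<sigma> assume "\<sigma> \<in> neighbourhood_complex (G_graph r p)"
    then show "\<phi> ` \<sigma> \<subset> odd_part"
    proof (cases rule: neighbourhood_complex_cases)
      case 1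
      moreover from this have "\<phi> ` \<sigma> = \<sigma>"
        by (force simp: \<phi>_def)
      ultimately show ?thesis
        by simp
    next
      case 2
      then show ?thesis
        using part_intersections(4) by (intro outside) blast
    next
      case 3
      then show ?thesis
        using part_intersections(2) by (intro outside) blast
    next
      case 4
      then show ?thesis
        using part_intersections(1,2,7) by (intro outside) blast
    qed
  qed
  then show ?thesis
    using r by simp
qed

text \<open>Vertices outside the clique are sent by parity to hub + 1 or to the hub. The odd part
  collapses to hub + 1 and the even side to the hub, while the bridge, where 1 and 3 go to hub + 1,
  has an image avoiding the hub.\<close>

lemma k_connected_less_clique:
  assumes "k_connected_space j (geometric_realization (neighbourhood_complex (G_graph r p)))"
  shows "j < p - 2"
proof -
  define \<phi> where "\<phi> v = (if v \<in> clique then v else if odd v then hub + 1 else hub)" for v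
  have in_clique: "hub \<in> clique" "hub + 1 \<in> clique"
    using p by (auto simp: clique_def)
  moreover have "hub \<notin> {hub + 1}" "hub + 1 \<notin> {hub}"
    by simp_all
  ultimately have proper: "{hub + 1} \<subset> clique" "clique - {hub} \<subset> clique" "{hub} \<subset> clique"
    by blast+
  have "j < int (nat (p - 2))"
  proof (rule simplicial_retract_not_k_connected[OF _ _ _ _ _ _ _ assms])
    show "finite (pverts (G_graph r p))"
      using finite_parts by (simp add: pverts_G_graph)
    show "\<sigma> \<subseteq> pverts (G_graph r p)" if "\<sigma> \<in> neighbourhood_complex (G_graph r p)" for \<sigma>
      using that by (simp add: neighbourhood_complex_def)
    show "clique \<subseteq> pverts (G_graph r p)"
      by (auto simp: pverts_G_graph)
    show "card clique = nat (p - 2) + 2"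
      using p by (simp add: card_clique)
    show "boundary clique \<subseteq> neighbourhood_complex (G_graph r p)"
      by (auto simp: neighbourhood_complex_G_graph)
    show "\<phi> v = v" if "v \<in> clique" for v
      using that by (simp add: \<phi>_def)
    fix \<sigma> assume "\<sigma> \<in> neighbourhood_complex (G_graph r p)"
    then show "\<phi> ` \<sigma> \<subset> clique"
    proof (cases rule: neighbourhood_complex_cases)
      case 1
      have "\<phi> v \<in> {hub + 1}" if "v \<in> \<sigma>" for v
      proof -
        have "v \<in> odd_part"
          using that 1 by blast
        then have "v \<notin> clique" "odd v"
          using part_intersections(2) by (blast, simp add: odd_part_def)
        then show ?thesis
          by (simp add: \<phi>_def)
      qed
      then have "\<phi> ` \<sigma> \<subseteq> {hub + 1}"
        by (rule image_subsetI)
      then show ?thesis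
        by (rule subset_psubset_trans[OF _ proper(1)])
    next
      case 2
      have "\<phi> v \<in> clique - {hub}" if "v \<in> \<sigma>" for v
      proof (cases "v \<in> clique")
        case True
        then show ?thesis
          using that 2 part_intersections(8) by (auto simp: \<phi>_def)
      next
        case False
        then have "v \<in> {1, 3}"
          using that 2 by (auto simp: bridge_def clique_def)
        then have "odd v"
          by auto
        then show ?thesis
          using False in_clique by (simp add: \<phi>_def)
      qed
      then have "\<phi> ` \<sigma> \<subseteq> clique - {hub}"
        by (rule image_subsetI)
      then show ?thesis
        by (rule subset_psubset_trans[OF _ proper(2)])
    next
      case 3
      moreover from this have "\<phi> ` \<sigma> = \<sigma>"
        by (force simp: \<phi>_def)
      ultimately show ?thesis
        by simp
    next
      case 4
      have "\<phi> v \<in> {hub}" if "v \<in> \<sigma>" for v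
      proof (cases "v = hub")
        case False
        then have "v \<in> even_part"
          using that 4 by blast
        then have "v \<notin> clique" "even v"
          using part_intersections(3) by (blast, simp add: even_part_def)
        then show ?thesis
          by (simp add: \<phi>_def)
      qed (simp add: \<phi>_def in_clique(1))
      then have "\<phi> ` \<sigma> \<subseteq> {hub}"
        by (rule image_subsetI)
      then show ?thesis
        by (rule subset_psubset_trans[OF _ proper(3)])
    qed
  qed
  then show ?thesis
    using p by simp
qed

lemma has_Conn_G_graph:
  "has_Conn (geometric_realization (neighbourhood_complex (G_graph r p))) (min (2 * r) (p - 3))"
  unfolding has_Conn_def
proof (intro conjI allI impI)
  let ?K = "neighbourhood_complex (G_graph r p)"
  \<comment> \<open>Filling m-spheres takes cubes of dimension m + 1, which turns the bounds 2r + 1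
    and p - 2 into 2r and p - 3.\<close>
  have ext: "cube_extensor (Suc m) (polyhedron ?K)" if "int m \<le> min (2 * r) (p - 3)" for m
    using complex_extensor_neighbourhood_complex[of "Suc m"] that by (simp add: complex_extensor_def)
  \<comment> \<open>Extension from the empty set already provides a map of the cube into the
    polyhedron, hence a point of it.\<close>
  obtain g where "g ` cube (Suc 0) \<subseteq> polyhedron ?K"
    using cube_extensorE[OF ext[of 0], of "{}" undefined] r p by auto
  moreover have "(\<lambda>_. 0) \<in> cube (Suc 0)"
    by (simp add: cube_def)
  ultimately have "polyhedron ?K \<noteq> {}"
    by blast
  then show "k_connected_space (min (2 * r) (p - 3)) (geometric_realization ?K)"
    using ext by (rule k_connected_space_if_cube_extensor)
  show "j \<le> min (2 * r) (p - 3)" if "k_connected_space j (geometric_realization ?K)" for j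
    using k_connected_less_odd_part[OF that] k_connected_less_clique[OF that] by simp
qed

end

theorem mainTheorem10:
  fixes r p :: int
  assumes "r \<ge> 1" and "p \<ge> 5"
  shows "stiff (G_graph r p)
    \<and> has_vertex_connectivity (G_graph r p) 1
    \<and> has_Conn (geometric_realization (neighbourhood_complex (G_graph r p))) (min (2 * r) (p - 3))"
  using stiff_G_graph[OF assms] has_vertex_connectivity_G_graph[OF assms] has_Conn_G_graph[OF assms]
  by blast

end
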